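(* Let $R$ be an excellent domain of equal characteristic zero with a dualizing complex, and let $\mathfrak a,J\subseteq R$ be nonzero ideals with $\mathfrak a\subseteq\sqrt J$. If $J=(x_1,\dots,x_n)=(y_1,\dots,y_m)$, then $$c_{\mathrm{KH}}^{\underline x}(\mathfrak a)=c_{\mathrm{KH}}^{\underline y}(\mathfrak a).$$
   Context: Equal characteristic zero means $\mathbb Q\subseteq R$. Let $\pi:Z\to\operatorname{Spec}R$ be a log resolution of $(R,\mathfrak a)$: $\pi$ is proper birational, $Z$ is nonsingular integral, $\mathfrak a\mathcal O_Z=\mathcal O_Z(-D)$ for a divisor $D$ with simple normal crossing support, and the exceptional set is a divisor having simple normal crossing support together with $D$. For a sequence of generators $\underline x=x_1,\dots,x_n$ of $J$, with Koszul complex $\mathrm{Kos}_\bullet(\underline x)$, define $$c_{\mathrm{KH}}^{\underline x}(\mathfrak a)=\inf\{t\ge 0 : R\to \mathrm{Kos}_\bullet(\underline x)\otimes_R^{\mathbf L}\mathbf R\Gamma(Z,\mathcal O_Z(\lfloor tD\rfloor))\text{ is zero in the derived category }D(R)\},$$ where the map is the canonical one induced by $R\to\mathrm{Kos}_\bullet(\underline x)$ and $R\to\mathbf R\Gamma(Z,\mathcal O_Z)\to\mathbf R\Gamma(Z,\mathcal O_Z(\lfloor tD\rfloor))$. The complex $\mathbf R\Gamma(Z,\mathcal O_Z(\lfloor tD\rfloor))$ is independent of the choice of log resolution. *)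

theory Defs
  imports
    "HOL-Analysis.Abstract_Topology"
    "HOL-Library.Extended_Nat"
    "HOL-Library.Extended_Real"
    "HOL-Algebra.Module"
    "HOL-Algebra.Ideal_Product"
    "HOL-Algebra.Ring_Divisibility"
    "HOL-Algebra.Generated_Rings"
begin

section \<open>Commutative algebra\<close>

text \<open>
  Rings are records of session HOL-Algebra. \<open>Module.module\<close> is the locale of modules over a ring in
  that sense; the fields \<open>mult\<close> and \<open>one\<close> of a module record carry no meaning.
\<close>

definition rat_ring :: "rat ring" where
  "rat_ring = \<lparr>carrier = UNIV, monoid.mult = (*), monoid.one = 1, ring.zero = 0, ring.add = (+)\<rparr>"

definition equal_char_zero :: "'a ring \<Rightarrow> bool" where
  "equal_char_zero R \<longleftrightarrow> ring_hom rat_ring R \<noteq> {}"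

definition radical :: "'a ring \<Rightarrow> 'a set \<Rightarrow> 'a set" where
  "radical R J = {r \<in> carrier R. \<exists>n::nat. r [^]\<^bsub>R\<^esub> n \<in> J}"

primrec ideal_pow :: "'a ring \<Rightarrow> 'a set \<Rightarrow> nat \<Rightarrow> 'a set" where
  "ideal_pow A I 0 = carrier A"
| "ideal_pow A I (Suc n) = I \<cdot>\<^bsub>A\<^esub> ideal_pow A I n"

definition local_ring :: "'a ring \<Rightarrow> bool" where
  "local_ring A \<longleftrightarrow> cring A \<and> (\<exists>!M. maximalideal M A)"

definition max_id :: "'a ring \<Rightarrow> 'a set" where
  "max_id A = (THE M. maximalideal M A)"

definition residue_field :: "'a ring \<Rightarrow> 'a set ring" where
  "residue_field A = A Quot max_id A"

definition prime_chain :: "'a ring \<Rightarrow> 'a set set \<Rightarrow> bool" where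
  "prime_chain A C \<longleftrightarrow> (\<forall>P\<in>C. primeideal P A) \<and> (\<forall>P\<in>C. \<forall>Q\<in>C. P \<subseteq> Q \<or> Q \<subseteq> P)"

definition krull_dim :: "'a ring \<Rightarrow> enat" where
  "krull_dim A = (SUP C \<in> {C. finite C \<and> C \<noteq> {} \<and> prime_chain A C}. enat (card C - 1))"

definition reg_sys_params :: "'a ring \<Rightarrow> 'a set \<Rightarrow> bool" where
  "reg_sys_params A T \<longleftrightarrow>
     finite T \<and> T \<subseteq> carrier A \<and> Idl\<^bsub>A\<^esub> T = max_id A \<and> enat (card T) = krull_dim A"

definition regular_local_ring :: "'a ring \<Rightarrow> bool" where
  "regular_local_ring A \<longleftrightarrow> local_ring A \<and> noetherian_ring A \<and> (\<exists>T. reg_sys_params A T)"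


subsection \<open>Localization\<close>

definition loc_rel :: "'a ring \<Rightarrow> 'a set \<Rightarrow> (('a \<times> 'a) \<times> ('a \<times> 'a)) set" where
  "loc_rel A S = {((a, s), (b, t)). a \<in> carrier A \<and> s \<in> S \<and> b \<in> carrier A \<and> t \<in> S \<and>
     (\<exists>u\<in>S. u \<otimes>\<^bsub>A\<^esub> (a \<otimes>\<^bsub>A\<^esub> t \<ominus>\<^bsub>A\<^esub> b \<otimes>\<^bsub>A\<^esub> s) = \<zero>\<^bsub>A\<^esub>)}"

definition frac :: "'a ring \<Rightarrow> 'a set \<Rightarrow> 'a \<Rightarrow> 'a \<Rightarrow> ('a \<times> 'a) set" where
  "frac A S a s = loc_rel A S `` {(a, s)}"

definition localize :: "'a ring \<Rightarrow> 'a set \<Rightarrow> ('a \<times> 'a) set ring" where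
  "localize A S =
     \<lparr>carrier = (carrier A \<times> S) // loc_rel A S,
      monoid.mult = (\<lambda>X Y. \<Union>p\<in>X. \<Union>q\<in>Y. let (a, s) = p; (b, t) = q in frac A S (a \<otimes>\<^bsub>A\<^esub> b) (s \<otimes>\<^bsub>A\<^esub> t)),
      monoid.one = frac A S \<one>\<^bsub>A\<^esub> \<one>\<^bsub>A\<^esub>,
      ring.zero = frac A S \<zero>\<^bsub>A\<^esub> \<one>\<^bsub>A\<^esub>,
      ring.add = (\<lambda>X Y. \<Union>p\<in>X. \<Union>q\<in>Y. let (a, s) = p; (b, t) = q in
               frac A S (a \<otimes>\<^bsub>A\<^esub> t \<oplus>\<^bsub>A\<^esub> b \<otimes>\<^bsub>A\<^esub> s) (s \<otimes>\<^bsub>A\<^esub> t))\<rparr>"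

definition loc_prime :: "'a ring \<Rightarrow> 'a set \<Rightarrow> ('a \<times> 'a) set ring" where
  "loc_prime A P = localize A (carrier A - P)"

definition to_loc_prime :: "'a ring \<Rightarrow> 'a set \<Rightarrow> 'a \<Rightarrow> ('a \<times> 'a) set" where
  "to_loc_prime A P a = frac A (carrier A - P) a \<one>\<^bsub>A\<^esub>"

definition regular_ring :: "'a ring \<Rightarrow> bool" where
  "regular_ring A \<longleftrightarrow> cring A \<and> noetherian_ring A \<and>
     (\<forall>P. primeideal P A \<longrightarrow> regular_local_ring (loc_prime A P))"


subsection \<open>Free modules, quotients and tensor products\<close>

definition fun_supp :: "'a ring \<Rightarrow> ('x \<Rightarrow> 'a) \<Rightarrow> 'x set" where
  "fun_supp R h = {p. h p \<noteq> \<zero>\<^bsub>R\<^esub>}"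

definition free_mod :: "'a ring \<Rightarrow> 'x set \<Rightarrow> ('a, 'x \<Rightarrow> 'a) module" where
  "free_mod R X =
     \<lparr>carrier = {h. (\<forall>p. h p \<in> carrier R) \<and> finite (fun_supp R h) \<and> fun_supp R h \<subseteq> X},
      monoid.mult = undefined, monoid.one = undefined,
      ring.zero = (\<lambda>_. \<zero>\<^bsub>R\<^esub>),
      ring.add = (\<lambda>h k p. h p \<oplus>\<^bsub>R\<^esub> k p),
      smult = (\<lambda>r h p. r \<otimes>\<^bsub>R\<^esub> h p)\<rparr>"

definition single :: "'a ring \<Rightarrow> 'x \<Rightarrow> 'x \<Rightarrow> 'a" where
  "single R x = (\<lambda>p. if p = x then \<one>\<^bsub>R\<^esub> else \<zero>\<^bsub>R\<^esub>)"

text \<open>The monoid algebra of the commutative monoid on \<open>X\<close> with product \<open>op\<close> and unit \<open>e\<close>.\<close>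

definition monoid_alg ::
  "'a ring \<Rightarrow> 'x set \<Rightarrow> ('x \<Rightarrow> 'x \<Rightarrow> 'x) \<Rightarrow> 'x \<Rightarrow> ('x \<Rightarrow> 'a) ring" where
  "monoid_alg R X op e =
     \<lparr>carrier = carrier (free_mod R X),
      monoid.mult = (\<lambda>h k p. \<Oplus>\<^bsub>R\<^esub> q \<in> {q \<in> fun_supp R h \<times> fun_supp R k. op (fst q) (snd q) = p}.
                 h (fst q) \<otimes>\<^bsub>R\<^esub> k (snd q)),
      monoid.one = single R e,
      ring.zero = ring.zero (free_mod R X),
      ring.add = ring.add (free_mod R X)\<rparr>"

text \<open>The polynomial ring in \<open>n\<close> variables; a monomial is its exponent vector, extended by zero.\<close>

definition mpoly_ring :: "'a ring \<Rightarrow> nat \<Rightarrow> ((nat \<Rightarrow> nat) \<Rightarrow> 'a) ring" where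
  "mpoly_ring R n = monoid_alg R {e. \<forall>i\<ge>n. e i = 0} (\<lambda>e e' i. e i + e' i) (\<lambda>_. 0)"

definition mpoly_const :: "'a ring \<Rightarrow> 'a \<Rightarrow> (nat \<Rightarrow> nat) \<Rightarrow> 'a" where
  "mpoly_const R c = (\<lambda>e. if e = (\<lambda>_. 0) then c else \<zero>\<^bsub>R\<^esub>)"

definition mod_span :: "'a ring \<Rightarrow> ('a, 'm) module \<Rightarrow> 'm set \<Rightarrow> 'm set" where
  "mod_span R M S = \<Inter>{N. submodule N R M \<and> S \<subseteq> N}"

definition quot_mod :: "('a, 'm) module \<Rightarrow> 'm set \<Rightarrow> ('a, 'm set) module" where
  "quot_mod M N =
     \<lparr>carrier = a_rcosets\<^bsub>M\<^esub> N, monoid.mult = undefined, monoid.one = undefined,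
      ring.zero = N, ring.add = set_add M,
      smult = (\<lambda>r X. \<Union>m\<in>X. N +>\<^bsub>M\<^esub> (r \<odot>\<^bsub>M\<^esub> m))\<rparr>"

definition restrict_scalars :: "('a \<Rightarrow> 's) \<Rightarrow> ('s, 'm) module \<Rightarrow> ('a, 'm) module" where
  "restrict_scalars \<phi> M =
     \<lparr>carrier = carrier M, monoid.mult = monoid.mult M, monoid.one = monoid.one M, ring.zero = ring.zero M, ring.add = ring.add M,
      smult = (\<lambda>r. smult M (\<phi> r))\<rparr>"

definition self_mod :: "'s ring \<Rightarrow> ('s, 's) module" where
  "self_mod A =
     \<lparr>carrier = carrier A, monoid.mult = monoid.mult A, monoid.one = monoid.one A, ring.zero = ring.zero A,
      ring.add = ring.add A, smult = monoid.mult A\<rparr>"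

definition tensor_rels ::
  "'a ring \<Rightarrow> ('a, 'm) module \<Rightarrow> ('a, 'n) module \<Rightarrow> ('m \<times> 'n \<Rightarrow> 'a) set" where
  "tensor_rels R M N = (let F = free_mod R (carrier M \<times> carrier N) in
     {single R (m \<oplus>\<^bsub>M\<^esub> m', n) \<ominus>\<^bsub>F\<^esub> (single R (m, n) \<oplus>\<^bsub>F\<^esub> single R (m', n)) | m m' n.
        m \<in> carrier M \<and> m' \<in> carrier M \<and> n \<in> carrier N} \<union>
     {single R (m, n \<oplus>\<^bsub>N\<^esub> n') \<ominus>\<^bsub>F\<^esub> (single R (m, n) \<oplus>\<^bsub>F\<^esub> single R (m, n')) | m n n'.
        m \<in> carrier M \<and> n \<in> carrier N \<and> n' \<in> carrier N} \<union>
     {single R (r \<odot>\<^bsub>M\<^esub> m, n) \<ominus>\<^bsub>F\<^esub> (r \<odot>\<^bsub>F\<^esub> single R (m, n)) | r m n.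
        r \<in> carrier R \<and> m \<in> carrier M \<and> n \<in> carrier N} \<union>
     {single R (m, r \<odot>\<^bsub>N\<^esub> n) \<ominus>\<^bsub>F\<^esub> (r \<odot>\<^bsub>F\<^esub> single R (m, n)) | r m n.
        r \<in> carrier R \<and> m \<in> carrier M \<and> n \<in> carrier N})"

definition tensor_null ::
  "'a ring \<Rightarrow> ('a, 'm) module \<Rightarrow> ('a, 'n) module \<Rightarrow> ('m \<times> 'n \<Rightarrow> 'a) set" where
  "tensor_null R M N = mod_span R (free_mod R (carrier M \<times> carrier N)) (tensor_rels R M N)"

definition tensor_mod ::
  "'a ring \<Rightarrow> ('a, 'm) module \<Rightarrow> ('a, 'n) module \<Rightarrow> ('a, ('m \<times> 'n \<Rightarrow> 'a) set) module" where
  "tensor_mod R M N = quot_mod (free_mod R (carrier M \<times> carrier N)) (tensor_null R M N)"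

definition tensor_elt ::
  "'a ring \<Rightarrow> ('a, 'm) module \<Rightarrow> ('a, 'n) module \<Rightarrow> 'm \<Rightarrow> 'n \<Rightarrow> ('m \<times> 'n \<Rightarrow> 'a) set" where
  "tensor_elt R M N m n =
     tensor_null R M N +>\<^bsub>free_mod R (carrier M \<times> carrier N)\<^esub> single R (m, n)"

text \<open>\<open>f \<otimes> g\<close> sends the class of \<open>\<Sum> h(m,n) (m,n)\<close> to the class of \<open>\<Sum> h(m,n) (f m, g n)\<close>.\<close>

definition tensor_map ::
  "'a ring \<Rightarrow> ('a, 'm2) module \<Rightarrow> ('a, 'n2) module \<Rightarrow> ('m1 \<Rightarrow> 'm2) \<Rightarrow> ('n1 \<Rightarrow> 'n2) \<Rightarrow>
   ('m1 \<times> 'n1 \<Rightarrow> 'a) set \<Rightarrow> ('m2 \<times> 'n2 \<Rightarrow> 'a) set" where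
  "tensor_map R M' N' f g X =
     (\<Union>h\<in>X. tensor_null R M' N' +>\<^bsub>free_mod R (carrier M' \<times> carrier N')\<^esub>
        (\<lambda>q. \<Oplus>\<^bsub>R\<^esub> p \<in> {p \<in> fun_supp R h. (f (fst p), g (snd p)) = q}. h p))"

text \<open>
  The tensor product of two \<open>R\<close>-algebras given by ring homomorphisms \<open>f\<close> and \<open>g\<close>: same generators
  and relations, with the multiplication determined by \<open>(a \<otimes> b)(a' \<otimes> b') = aa' \<otimes> bb'\<close>.
\<close>

definition alg_tensor_free ::
  "'a ring \<Rightarrow> 'b ring \<Rightarrow> 'c ring \<Rightarrow> ('b \<times> 'c \<Rightarrow> 'a) ring" where
  "alg_tensor_free R A B = monoid_alg R (carrier A \<times> carrier B)
     (\<lambda>p q. (fst p \<otimes>\<^bsub>A\<^esub> fst q, snd p \<otimes>\<^bsub>B\<^esub> snd q)) (\<one>\<^bsub>A\<^esub>, \<one>\<^bsub>B\<^esub>)"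

definition alg_tensor_null ::
  "'a ring \<Rightarrow> ('a \<Rightarrow> 'b) \<Rightarrow> 'b ring \<Rightarrow> ('a \<Rightarrow> 'c) \<Rightarrow> 'c ring \<Rightarrow> ('b \<times> 'c \<Rightarrow> 'a) set" where
  "alg_tensor_null R f A g B = Idl\<^bsub>alg_tensor_free R A B\<^esub>
     (tensor_rels R (restrict_scalars f (self_mod A)) (restrict_scalars g (self_mod B)))"

definition alg_tensor ::
  "'a ring \<Rightarrow> ('a \<Rightarrow> 'b) \<Rightarrow> 'b ring \<Rightarrow> ('a \<Rightarrow> 'c) \<Rightarrow> 'c ring \<Rightarrow> ('b \<times> 'c \<Rightarrow> 'a) set ring" where
  "alg_tensor R f A g B = alg_tensor_free R A B Quot alg_tensor_null R f A g B"

definition alg_tensor_elt ::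
  "'a ring \<Rightarrow> ('a \<Rightarrow> 'b) \<Rightarrow> 'b ring \<Rightarrow> ('a \<Rightarrow> 'c) \<Rightarrow> 'c ring \<Rightarrow> 'b \<Rightarrow> 'c \<Rightarrow> ('b \<times> 'c \<Rightarrow> 'a) set" where
  "alg_tensor_elt R f A g B a b =
     alg_tensor_null R f A g B +>\<^bsub>alg_tensor_free R A B\<^esub> single R (a, b)"


subsection \<open>Excellent rings\<close>

text \<open>
  Finitely generated \<open>R\<close>-algebras are, up to isomorphism, the quotients of the rings
  \<open>mpoly_ring R n\<close>; all properties below are invariant under isomorphism.
\<close>

definition max_prime_chains :: "'a ring \<Rightarrow> 'a set \<Rightarrow> 'a set \<Rightarrow> 'a set set set" where
  "max_prime_chains A P Q = (let \<C> = {C. prime_chain A C \<and> P \<in> C \<and> Q \<in> C \<and> (\<forall>X\<in>C. P \<subseteq> X \<and> X \<subseteq> Q)}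
     in {C \<in> \<C>. \<forall>C'\<in>\<C>. C \<subseteq> C' \<longrightarrow> C' = C})"

definition catenary :: "'a ring \<Rightarrow> bool" where
  "catenary A \<longleftrightarrow> (\<forall>P Q. primeideal P A \<and> primeideal Q A \<and> P \<subseteq> Q \<longrightarrow>
     (\<exists>n. \<forall>C \<in> max_prime_chains A P Q. finite C \<and> card C = n))"

definition universally_catenary :: "'a ring \<Rightarrow> bool" where
  "universally_catenary R \<longleftrightarrow>
     (\<forall>n I. ideal I (mpoly_ring R n) \<longrightarrow> catenary (mpoly_ring R n Quot I))"

definition J1_ring :: "'a ring \<Rightarrow> bool" where
  "J1_ring A \<longleftrightarrow> (\<exists>I. ideal I A \<and>
     (\<forall>P. primeideal P A \<longrightarrow> (regular_local_ring (loc_prime A P) \<longleftrightarrow> \<not> I \<subseteq> P)))"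

definition J2_ring :: "'a ring \<Rightarrow> bool" where
  "J2_ring R \<longleftrightarrow> (\<forall>n I. ideal I (mpoly_ring R n) \<longrightarrow> J1_ring (mpoly_ring R n Quot I))"

text \<open>The completion of a local ring, as the inverse limit of the \<open>A/m\<^sup>n\<close>.\<close>

definition completion :: "'a ring \<Rightarrow> (nat \<Rightarrow> 'a set) ring" where
  "completion A = (let Q = (\<lambda>n. A Quot ideal_pow A (max_id A) n) in
     \<lparr>carrier = {s. \<forall>n. s n \<in> carrier (Q n) \<and> s (Suc n) \<subseteq> s n},
      monoid.mult = (\<lambda>s t n. s n \<otimes>\<^bsub>Q n\<^esub> t n),
      monoid.one = (\<lambda>n. \<one>\<^bsub>Q n\<^esub>),
      ring.zero = (\<lambda>n. \<zero>\<^bsub>Q n\<^esub>),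
      ring.add = (\<lambda>s t n. s n \<oplus>\<^bsub>Q n\<^esub> t n)\<rparr>)"

definition to_completion :: "'a ring \<Rightarrow> 'a \<Rightarrow> nat \<Rightarrow> 'a set" where
  "to_completion A a = (\<lambda>n. ideal_pow A (max_id A) n +>\<^bsub>A\<^esub> a)"

definition kappa :: "'a ring \<Rightarrow> 'a set \<Rightarrow> ('a \<times> 'a) set set ring" where
  "kappa A P = residue_field (loc_prime A P)"

definition to_kappa :: "'a ring \<Rightarrow> 'a set \<Rightarrow> 'a \<Rightarrow> ('a \<times> 'a) set set" where
  "to_kappa A P a = max_id (loc_prime A P) +>\<^bsub>loc_prime A P\<^esub> to_loc_prime A P a"

text \<open>
  The fibre of \<open>Spec B\<close> over \<open>Q \<in> Spec A\<close> is geometrically regular: \<open>L \<otimes>\<^sub>A B = L \<otimes>\<^bsub>\<kappa>(Q)\<^esub> (\<kappa>(Q) \<otimes>\<^sub>A B)\<close>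
  is regular for every finite extension field \<open>L\<close> of \<open>\<kappa>(Q)\<close>. Up to isomorphism, these \<open>L\<close> are the
  quotients of polynomial rings over \<open>\<kappa>(Q)\<close> by maximal ideals (Nullstellensatz).
\<close>

definition geom_regular_fibre :: "'a ring \<Rightarrow> ('a \<Rightarrow> 'b) \<Rightarrow> 'b ring \<Rightarrow> 'a set \<Rightarrow> bool" where
  "geom_regular_fibre A f B Q \<longleftrightarrow>
     (\<forall>n M. maximalideal M (mpoly_ring (kappa A Q) n) \<longrightarrow>
        regular_ring (alg_tensor A
          (\<lambda>a. M +>\<^bsub>mpoly_ring (kappa A Q) n\<^esub> mpoly_const (kappa A Q) (to_kappa A Q a))
          (mpoly_ring (kappa A Q) n Quot M)
          f B))"

definition G_ring :: "'a ring \<Rightarrow> bool" where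
  "G_ring R \<longleftrightarrow> (\<forall>P. primeideal P R \<longrightarrow>
     (\<forall>Q. primeideal Q (loc_prime R P) \<longrightarrow>
        geom_regular_fibre (loc_prime R P) (to_completion (loc_prime R P))
          (completion (loc_prime R P)) Q))"

definition excellent :: "'a ring \<Rightarrow> bool" where
  "excellent R \<longleftrightarrow>
     cring R \<and> noetherian_ring R \<and> universally_catenary R \<and> J2_ring R \<and> G_ring R"


section \<open>Complexes of modules\<close>

definition mod_hom :: "'a ring \<Rightarrow> ('a, 'm) module \<Rightarrow> ('a, 'n) module \<Rightarrow> ('m \<Rightarrow> 'n) set" where
  "mod_hom R M N = {f \<in> carrier M \<rightarrow> carrier N.
     (\<forall>x\<in>carrier M. \<forall>y\<in>carrier M. f (x \<oplus>\<^bsub>M\<^esub> y) = f x \<oplus>\<^bsub>N\<^esub> f y) \<and>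
     (\<forall>r\<in>carrier R. \<forall>x\<in>carrier M. f (r \<odot>\<^bsub>M\<^esub> x) = r \<odot>\<^bsub>N\<^esub> f x)}"

text \<open>Complexes are indexed cohomologically.\<close>

record ('a, 'm) cplx =
  obj :: "int \<Rightarrow> ('a, 'm) module"
  diff :: "int \<Rightarrow> 'm \<Rightarrow> 'm"

definition is_complex :: "'a ring \<Rightarrow> ('a, 'm) cplx \<Rightarrow> bool" where
  "is_complex R C \<longleftrightarrow>
     (\<forall>i. Module.module R (obj C i) \<and> diff C i \<in> mod_hom R (obj C i) (obj C (i + 1)) \<and>
        (\<forall>x\<in>carrier (obj C i). diff C (i + 1) (diff C i x) = \<zero>\<^bsub>obj C (i + 2)\<^esub>))"

definition cocycles :: "('a, 'm) cplx \<Rightarrow> int \<Rightarrow> 'm set" where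
  "cocycles C i = {x \<in> carrier (obj C i). diff C i x = \<zero>\<^bsub>obj C (i + 1)\<^esub>}"

definition coboundaries :: "('a, 'm) cplx \<Rightarrow> int \<Rightarrow> 'm set" where
  "coboundaries C i = diff C (i - 1) ` carrier (obj C (i - 1))"

definition chain_map ::
  "'a ring \<Rightarrow> ('a, 'm) cplx \<Rightarrow> ('a, 'n) cplx \<Rightarrow> (int \<Rightarrow> 'm \<Rightarrow> 'n) \<Rightarrow> bool" where
  "chain_map R C D f \<longleftrightarrow> (\<forall>i. f i \<in> mod_hom R (obj C i) (obj D i) \<and>
     (\<forall>x\<in>carrier (obj C i). f (i + 1) (diff C i x) = diff D i (f i x)))"

text \<open>The two conjuncts in the body are injectivity and surjectivity on cohomology.\<close>

definition quasi_iso ::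
  "'a ring \<Rightarrow> ('a, 'm) cplx \<Rightarrow> ('a, 'n) cplx \<Rightarrow> (int \<Rightarrow> 'm \<Rightarrow> 'n) \<Rightarrow> bool" where
  "quasi_iso R C D f \<longleftrightarrow> chain_map R C D f \<and>
     (\<forall>i. (\<forall>z\<in>cocycles C i. f i z \<in> coboundaries D i \<longrightarrow> z \<in> coboundaries C i) \<and>
          (\<forall>w\<in>cocycles D i. \<exists>z\<in>cocycles C i. w \<ominus>\<^bsub>obj D i\<^esub> f i z \<in> coboundaries D i))"

definition null_homotopic ::
  "'a ring \<Rightarrow> ('a, 'm) cplx \<Rightarrow> ('a, 'n) cplx \<Rightarrow> (int \<Rightarrow> 'm \<Rightarrow> 'n) \<Rightarrow> bool" where
  "null_homotopic R C D f \<longleftrightarrow> (\<exists>h. (\<forall>i. h i \<in> mod_hom R (obj C i) (obj D (i - 1))) \<and>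
     (\<forall>i. \<forall>x\<in>carrier (obj C i).
        f i x = diff D (i - 1) (h i x) \<oplus>\<^bsub>obj D i\<^esub> h (i + 1) (diff C i x)))"

text \<open>
  A chain map \<open>f : C \<longrightarrow> D\<close> becomes zero in the derived category iff some quasi-isomorphism into \<open>C\<close>
  makes the composite null-homotopic (the derived category is the localization of the homotopy
  category at quasi-isomorphisms). The auxiliary complex has its entries in the type of those of
  \<open>C\<close>; this is no restriction when \<open>C\<close> is a bounded above complex of projectives, such as \<open>R[0]\<close>,
  because then \<open>C\<close> itself with the identity serves whenever any quasi-isomorphism does.
\<close>

definition zero_in_derived_cat ::
  "'a ring \<Rightarrow> ('a, 'm) cplx \<Rightarrow> ('a, 'n) cplx \<Rightarrow> (int \<Rightarrow> 'm \<Rightarrow> 'n) \<Rightarrow> bool" where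
  "zero_in_derived_cat R C D f \<longleftrightarrow> (\<exists>(C' :: ('a, 'm) cplx) s.
     is_complex R C' \<and> quasi_iso R C' C s \<and> null_homotopic R C' D (\<lambda>i x. f i (s i x)))"

definition zero_mod :: "('a, 'm) module \<Rightarrow> ('a, 'm) module" where
  "zero_mod M = M\<lparr>carrier := {\<zero>\<^bsub>M\<^esub>}\<rparr>"

definition ring_cplx :: "'a ring \<Rightarrow> ('a, 'a) cplx" where
  "ring_cplx R =
     \<lparr>obj = (\<lambda>i. if i = 0 then self_mod R else zero_mod (self_mod R)), diff = (\<lambda>_ _. \<zero>\<^bsub>R\<^esub>)\<rparr>"

definition tensor_cplx ::
  "'a ring \<Rightarrow> ('a, 'm) cplx \<Rightarrow> ('a, 'n) cplx \<Rightarrow> ('a, int \<Rightarrow> ('m \<times> 'n \<Rightarrow> 'a) set) cplx" where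
  "tensor_cplx R K M = (let T = (\<lambda>n i. tensor_mod R (obj K i) (obj M (n - i))) in
     \<lparr>obj = (\<lambda>n.
        \<lparr>carrier = {u. (\<forall>i. u i \<in> carrier (T n i)) \<and> finite {i. u i \<noteq> \<zero>\<^bsub>T n i\<^esub>}},
         monoid.mult = undefined, monoid.one = undefined,
         ring.zero = (\<lambda>i. \<zero>\<^bsub>T n i\<^esub>),
         ring.add = (\<lambda>u v i. u i \<oplus>\<^bsub>T n i\<^esub> v i),
         smult = (\<lambda>r u i. r \<odot>\<^bsub>T n i\<^esub> u i)\<rparr>),
      diff = (\<lambda>n u i.
        (let a = tensor_map R (obj K i) (obj M (n + 1 - i))
                   (diff K (i - 1)) (\<lambda>y. y) (u (i - 1));
             b = tensor_map R (obj K i) (obj M (n + 1 - i))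
                   (\<lambda>x. x) (diff M (n - i)) (u i)
         in if even i then a \<oplus>\<^bsub>T (n + 1) i\<^esub> b else a \<ominus>\<^bsub>T (n + 1) i\<^esub> b))\<rparr>)"

text \<open>
  The Koszul complex on \<open>x\<^sub>0, \<dots>, x\<^sub>n\<^sub>-\<^sub>1\<close>: the exterior power in homological degree \<open>p\<close> (cohomological
  degree \<open>-p\<close>) has basis \<open>e\<^sub>S\<close> for \<open>S \<subseteq> {..<n}\<close> with \<open>p\<close> elements, and
  \<open>d e\<^sub>S = \<Sum> i\<in>S. (-1)^#{j\<in>S. j < i} x\<^sub>i e\<^sub>S\<^sub>-\<^sub>{\<^sub>i\<^sub>}\<close>. The formula below is the coefficient of \<open>e\<^sub>T\<close>.
\<close>

definition koszul :: "'a ring \<Rightarrow> 'a list \<Rightarrow> ('a, nat set \<Rightarrow> 'a) cplx" where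
  "koszul R xs =
     \<lparr>obj = (\<lambda>k. free_mod R {S. S \<subseteq> {..<length xs} \<and> int (card S) = - k}),
      diff = (\<lambda>_ u T. if T \<subseteq> {..<length xs}
        then (\<Oplus>\<^bsub>R\<^esub> i \<in> {..<length xs} - T.
          (if even (card {j \<in> T. j < i}) then xs ! i \<otimes>\<^bsub>R\<^esub> u (insert i T)
           else \<ominus>\<^bsub>R\<^esub> (xs ! i \<otimes>\<^bsub>R\<^esub> u (insert i T))))
        else \<zero>\<^bsub>R\<^esub>)\<rparr>"

text \<open>
  \<open>Kos(xs) \<otimes>\<^sup>L M\<close> is the ordinary tensor product, as the Koszul complex is bounded and free.
  A map \<open>u : R \<longrightarrow> M\<^sup>0\<close> into cocycles represents \<open>R \<longrightarrow> M\<close>; tensoring it with \<open>R \<longrightarrow> Kos(xs)\<close>,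
  \<open>1 \<mapsto> e\<^bsub>\<emptyset>\<^esub>\<close>, gives the map below.
\<close>

definition koszul_unit ::
  "'a ring \<Rightarrow> 'a list \<Rightarrow> ('a, 'm) cplx \<Rightarrow> ('a \<Rightarrow> 'm) \<Rightarrow>
   int \<Rightarrow> 'a \<Rightarrow> int \<Rightarrow> ((nat set \<Rightarrow> 'a) \<times> 'm \<Rightarrow> 'a) set" where
  "koszul_unit R xs M u n r = (\<lambda>i. if n = 0 \<and> i = 0
     then tensor_elt R (obj (koszul R xs) 0) (obj M 0) (single R {}) (u r)
     else \<zero>\<^bsub>tensor_mod R (obj (koszul R xs) i) (obj M (n - i))\<^esub>)"


subsection \<open>Dualizing complexes\<close>

text \<open>
  The lifting property is tested on modules with elements in the type of \<open>R\<close>; this is equivalent to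
  injectivity by Baer's criterion.
\<close>

definition injective_module :: "'a ring \<Rightarrow> ('a, 'm) module \<Rightarrow> bool" where
  "injective_module R E \<longleftrightarrow> Module.module R E \<and>
     (\<forall>(M :: ('a, 'a) module) (N :: ('a, 'a) module) i f.
        Module.module R M \<and> Module.module R N \<and>
        i \<in> mod_hom R M N \<and> inj_on i (carrier M) \<and> f \<in> mod_hom R M E \<longrightarrow>
        (\<exists>g \<in> mod_hom R N E. \<forall>x\<in>carrier M. g (i x) = f x))"

definition hom_cplx :: "'a ring \<Rightarrow> ('a, 'm) cplx \<Rightarrow> ('a, 'n) cplx \<Rightarrow> ('a, int \<Rightarrow> 'm \<Rightarrow> 'n) cplx" where
  "hom_cplx R C D =
     \<lparr>obj = (\<lambda>n.
        \<lparr>carrier = {\<phi>. \<forall>i. \<phi> i \<in> mod_hom R (obj C i) (obj D (i + n)) \<inter> extensional (carrier (obj C i))},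
         monoid.mult = undefined, monoid.one = undefined,
         ring.zero = (\<lambda>i. \<lambda>x\<in>carrier (obj C i). \<zero>\<^bsub>obj D (i + n)\<^esub>),
         ring.add = (\<lambda>\<phi> \<psi> i. \<lambda>x\<in>carrier (obj C i). \<phi> i x \<oplus>\<^bsub>obj D (i + n)\<^esub> \<psi> i x),
         smult = (\<lambda>r \<phi> i. \<lambda>x\<in>carrier (obj C i). r \<odot>\<^bsub>obj D (i + n)\<^esub> \<phi> i x)\<rparr>),
      diff = (\<lambda>n \<phi> i. \<lambda>x\<in>carrier (obj C i).
        (let a = diff D (i + n) (\<phi> i x); b = \<phi> (i + 1) (diff C i x)
         in if even n then a \<ominus>\<^bsub>obj D (i + n + 1)\<^esub> b else a \<oplus>\<^bsub>obj D (i + n + 1)\<^esub> b))\<rparr>"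

definition homothety :: "('a, 'm) cplx \<Rightarrow> int \<Rightarrow> 'a \<Rightarrow> int \<Rightarrow> 'm \<Rightarrow> 'm" where
  "homothety C n r = (\<lambda>i. \<lambda>x\<in>carrier (obj C i).
     if n = 0 then r \<odot>\<^bsub>obj C i\<^esub> x else \<zero>\<^bsub>obj C (i + n)\<^esub>)"

text \<open>
  A dualizing complex, represented by a bounded complex \<open>W\<close> of injectives (finite injective
  dimension): cohomology is finitely generated and \<open>R \<longrightarrow> RHom(W, W) = Hom(W, W)\<close> is an isomorphism
  in the derived category.
\<close>

definition dualizing_complex :: "'a ring \<Rightarrow> ('a, 'm) cplx \<Rightarrow> bool" where
  "dualizing_complex R W \<longleftrightarrow> is_complex R W \<and>
     (\<forall>i. injective_module R (obj W i)) \<and>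
     (\<exists>N. \<forall>i. N < \<bar>i\<bar> \<longrightarrow> carrier (obj W i) = {\<zero>\<^bsub>obj W i\<^esub>}) \<and>
     (\<forall>i. \<exists>S. finite S \<and> S \<subseteq> cocycles W i \<and>
        mod_span R (obj W i) (S \<union> coboundaries W i) = cocycles W i) \<and>
     quasi_iso R (ring_cplx R) (hom_cplx R W W) (homothety W)"


section \<open>Schemes\<close>

record ('p, 's) rspace =
  topol :: "'p topology"
  sect :: "'p set \<Rightarrow> 's ring"
  restr :: "'p set \<Rightarrow> 'p set \<Rightarrow> 's \<Rightarrow> 's"

abbreviation pts :: "('p, 's) rspace \<Rightarrow> 'p set" where
  "pts X \<equiv> topspace (topol X)"

definition sheaf_of_sets ::
  "'p topology \<Rightarrow> ('p set \<Rightarrow> 's set) \<Rightarrow> ('p set \<Rightarrow> 'p set \<Rightarrow> 's \<Rightarrow> 's) \<Rightarrow> bool" where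
  "sheaf_of_sets T F r \<longleftrightarrow>
     (\<forall>U V. openin T U \<and> openin T V \<and> V \<subseteq> U \<longrightarrow> r U V \<in> F U \<rightarrow> F V) \<and>
     (\<forall>U s. openin T U \<and> s \<in> F U \<longrightarrow> r U U s = s) \<and>
     (\<forall>U V W s. openin T U \<and> openin T V \<and> openin T W \<and> V \<subseteq> U \<and> W \<subseteq> V \<and> s \<in> F U \<longrightarrow>
        r V W (r U V s) = r U W s) \<and>
     (\<forall>\<U> s. (\<forall>U\<in>\<U>. openin T U \<and> s U \<in> F U) \<and>
        (\<forall>U\<in>\<U>. \<forall>V\<in>\<U>. r U (U \<inter> V) (s U) = r V (U \<inter> V) (s V)) \<longrightarrow>
        (\<exists>!t. t \<in> F (\<Union>\<U>) \<and> (\<forall>U\<in>\<U>. r (\<Union>\<U>) U t = s U)))"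

definition ringed_space :: "('p, 's) rspace \<Rightarrow> bool" where
  "ringed_space X \<longleftrightarrow>
     (\<forall>U. openin (topol X) U \<longrightarrow> cring (sect X U)) \<and>
     (\<forall>U V. openin (topol X) U \<and> openin (topol X) V \<and> V \<subseteq> U \<longrightarrow>
        restr X U V \<in> ring_hom (sect X U) (sect X V)) \<and>
     sheaf_of_sets (topol X) (\<lambda>U. carrier (sect X U)) (restr X)"

definition germ_rel ::
  "('p, 's) rspace \<Rightarrow> 'p \<Rightarrow> (('p set \<times> 's) \<times> ('p set \<times> 's)) set" where
  "germ_rel X x = {((U, s), (V, t)).
     openin (topol X) U \<and> x \<in> U \<and> s \<in> carrier (sect X U) \<and>
     openin (topol X) V \<and> x \<in> V \<and> t \<in> carrier (sect X V) \<and>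
     (\<exists>W. openin (topol X) W \<and> x \<in> W \<and> W \<subseteq> U \<inter> V \<and> restr X U W s = restr X V W t)}"

definition germ :: "('p, 's) rspace \<Rightarrow> 'p \<Rightarrow> 'p set \<Rightarrow> 's \<Rightarrow> ('p set \<times> 's) set" where
  "germ X x U s = germ_rel X x `` {(U, s)}"

definition stalk :: "('p, 's) rspace \<Rightarrow> 'p \<Rightarrow> ('p set \<times> 's) set ring" where
  "stalk X x =
     \<lparr>carrier = {germ X x U s | U s. openin (topol X) U \<and> x \<in> U \<and> s \<in> carrier (sect X U)},
      monoid.mult = (\<lambda>a b. \<Union>p\<in>a. \<Union>q\<in>b. let (U, s) = p; (V, t) = q in germ X x (U \<inter> V)
                (restr X U (U \<inter> V) s \<otimes>\<^bsub>sect X (U \<inter> V)\<^esub> restr X V (U \<inter> V) t)),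
      monoid.one = germ X x (pts X) \<one>\<^bsub>sect X (pts X)\<^esub>,
      ring.zero = germ X x (pts X) \<zero>\<^bsub>sect X (pts X)\<^esub>,
      ring.add = (\<lambda>a b. \<Union>p\<in>a. \<Union>q\<in>b. let (U, s) = p; (V, t) = q in germ X x (U \<inter> V)
                (restr X U (U \<inter> V) s \<oplus>\<^bsub>sect X (U \<inter> V)\<^esub> restr X V (U \<inter> V) t))\<rparr>"

definition locally_ringed_space :: "('p, 's) rspace \<Rightarrow> bool" where
  "locally_ringed_space X \<longleftrightarrow> ringed_space X \<and> (\<forall>x\<in>pts X. local_ring (stalk X x))"

definition preim :: "('p, 's) rspace \<Rightarrow> ('p \<Rightarrow> 'q) \<Rightarrow> 'q set \<Rightarrow> 'p set" where
  "preim X f V = {x \<in> pts X. f x \<in> V}"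

text \<open>
  A morphism consists of a map \<open>f\<close> on points and, for each open \<open>V\<close> of the target, a ring
  homomorphism \<open>F V\<close> from sections on \<open>V\<close> to sections on its preimage. The last conjunct says that
  the induced maps on stalks are local.
\<close>

definition lrs_morphism ::
  "('p, 's) rspace \<Rightarrow> ('q, 't) rspace \<Rightarrow> ('p \<Rightarrow> 'q) \<Rightarrow> ('q set \<Rightarrow> 't \<Rightarrow> 's) \<Rightarrow> bool" where
  "lrs_morphism X Y f F \<longleftrightarrow>
     continuous_map (topol X) (topol Y) f \<and>
     (\<forall>V. openin (topol Y) V \<longrightarrow> F V \<in> ring_hom (sect Y V) (sect X (preim X f V))) \<and>
     (\<forall>V W t. openin (topol Y) V \<and> openin (topol Y) W \<and> W \<subseteq> V \<and> t \<in> carrier (sect Y V) \<longrightarrow>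
        F W (restr Y V W t) = restr X (preim X f V) (preim X f W) (F V t)) \<and>
     (\<forall>x\<in>pts X. \<forall>V t. openin (topol Y) V \<and> f x \<in> V \<and> t \<in> carrier (sect Y V) \<and>
        germ X x (preim X f V) (F V t) \<in> Units (stalk X x) \<longrightarrow>
        germ Y (f x) V t \<in> Units (stalk Y (f x)))"

definition lrs_iso ::
  "('p, 's) rspace \<Rightarrow> ('q, 't) rspace \<Rightarrow> ('p \<Rightarrow> 'q) \<Rightarrow> ('q set \<Rightarrow> 't \<Rightarrow> 's) \<Rightarrow> bool" where
  "lrs_iso X Y f F \<longleftrightarrow> lrs_morphism X Y f F \<and> homeomorphic_map (topol X) (topol Y) f \<and>
     (\<forall>V. openin (topol Y) V \<longrightarrow>
        bij_betw (F V) (carrier (sect Y V)) (carrier (sect X (preim X f V))))"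

definition open_subspace :: "('p, 's) rspace \<Rightarrow> 'p set \<Rightarrow> ('p, 's) rspace" where
  "open_subspace X U = X\<lparr>topol := subtopology (topol X) U\<rparr>"

definition spec_top :: "'a ring \<Rightarrow> 'a set topology" where
  "spec_top A = topology_generated_by {{P. primeideal P A \<and> a \<notin> P} | a. a \<in> carrier A}"

definition Spec :: "'a ring \<Rightarrow> ('a set, 'a set \<Rightarrow> ('a \<times> 'a) set) rspace" where
  "Spec A =
     \<lparr>topol = spec_top A,
      sect = (\<lambda>U.
        \<lparr>carrier = {s \<in> extensional U. \<forall>P\<in>U. s P \<in> carrier (loc_prime A P) \<and>
            (\<exists>V. openin (spec_top A) V \<and> P \<in> V \<and> V \<subseteq> U \<and>
              (\<exists>a\<in>carrier A. \<exists>b\<in>carrier A. \<forall>Q\<in>V. b \<notin> Q \<and> s Q = frac A (carrier A - Q) a b))},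
         monoid.mult = (\<lambda>s t. \<lambda>P\<in>U. s P \<otimes>\<^bsub>loc_prime A P\<^esub> t P),
         monoid.one = (\<lambda>P\<in>U. \<one>\<^bsub>loc_prime A P\<^esub>),
         ring.zero = (\<lambda>P\<in>U. \<zero>\<^bsub>loc_prime A P\<^esub>),
         ring.add = (\<lambda>s t. \<lambda>P\<in>U. s P \<oplus>\<^bsub>loc_prime A P\<^esub> t P)\<rparr>),
      restr = (\<lambda>U V s. restrict s V)\<rparr>"

definition spec_global :: "'a ring \<Rightarrow> 'a \<Rightarrow> 'a set \<Rightarrow> ('a \<times> 'a) set" where
  "spec_global A a = (\<lambda>P\<in>pts (Spec A). to_loc_prime A P a)"

definition affine_open :: "('p, 's) rspace \<Rightarrow> 'p set \<Rightarrow> bool" where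
  "affine_open X U \<longleftrightarrow> openin (topol X) U \<and>
     (\<exists>f F. lrs_iso (open_subspace X U) (Spec (sect X U)) f F)"

definition is_scheme :: "('p, 's) rspace \<Rightarrow> bool" where
  "is_scheme X \<longleftrightarrow> locally_ringed_space X \<and> (\<forall>x\<in>pts X. \<exists>U. x \<in> U \<and> affine_open X U)"

definition integral_scheme :: "('p, 's) rspace \<Rightarrow> bool" where
  "integral_scheme X \<longleftrightarrow> is_scheme X \<and> pts X \<noteq> {} \<and>
     (\<forall>U. openin (topol X) U \<and> U \<noteq> {} \<longrightarrow> domain (sect X U))"

definition nonsingular :: "('p, 's) rspace \<Rightarrow> bool" where
  "nonsingular X \<longleftrightarrow> (\<forall>x\<in>pts X. regular_local_ring (stalk X x))"


subsection \<open>Proper birational morphisms to an affine scheme\<close>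

text \<open>The homomorphism \<open>R \<longrightarrow> \<Gamma>(X, O\<^sub>X)\<close> given by a morphism \<open>X \<longrightarrow> Spec R\<close>.\<close>

definition structure_hom ::
  "'a ring \<Rightarrow> ('a set set \<Rightarrow> ('a set \<Rightarrow> ('a \<times> 'a) set) \<Rightarrow> 's) \<Rightarrow> 'a \<Rightarrow> 's" where
  "structure_hom R F r = F (pts (Spec R)) (spec_global R r)"

definition res_field :: "('p, 's) rspace \<Rightarrow> 'p \<Rightarrow> ('p set \<times> 's) set set ring" where
  "res_field X x = residue_field (stalk X x)"

definition val_at :: "('p, 's) rspace \<Rightarrow> 'p \<Rightarrow> 'p set \<Rightarrow> 's \<Rightarrow> ('p set \<times> 's) set set" where
  "val_at X x U s = max_id (stalk X x) +>\<^bsub>stalk X x\<^esub> germ X x U s"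

text \<open>
  The fibre product of \<open>X\<close> and \<open>Y\<close> over \<open>Spec R\<close>, where the structure morphisms are given by
  \<open>a : R \<longrightarrow> \<Gamma>(X, O\<^sub>X)\<close> and \<open>b : R \<longrightarrow> \<Gamma>(Y, O\<^sub>Y)\<close>. Its points are the triples \<open>(x, y, P)\<close> with \<open>P\<close> a
  prime of \<open>\<kappa>(x) \<otimes>\<^sub>R \<kappa>(y)\<close>. A basis of the topology is given by the sets where
  \<open>\<Sum> s\<^sub>i \<otimes> t\<^sub>i \<in> O(U) \<otimes>\<^sub>R O(V)\<close> does not vanish, over the product of opens \<open>U\<close> and \<open>V\<close>.
\<close>

definition fp_tensor where
  "fp_tensor R X a Y b x y = alg_tensor R
     (\<lambda>r. val_at X x (pts X) (a r)) (res_field X x)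
     (\<lambda>r. val_at Y y (pts Y) (b r)) (res_field Y y)"

definition fp_elt where
  "fp_elt R X a Y b x y c d = alg_tensor_elt R
     (\<lambda>r. val_at X x (pts X) (a r)) (res_field X x)
     (\<lambda>r. val_at Y y (pts Y) (b r)) (res_field Y y) c d"

definition fp_points where
  "fp_points R X a Y b = {(x, y, P). x \<in> pts X \<and> y \<in> pts Y \<and>
     primeideal P (fp_tensor R X a Y b x y)}"

definition fp_value where
  "fp_value R X a Y b x y U V l =
     foldr (\<lambda>(s, t) acc. fp_elt R X a Y b x y (val_at X x U s) (val_at Y y V t)
              \<oplus>\<^bsub>fp_tensor R X a Y b x y\<^esub> acc)
       l \<zero>\<^bsub>fp_tensor R X a Y b x y\<^esub>"

definition fp_top where
  "fp_top R X a Y b = topology_generated_by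
     {{(x, y, P) \<in> fp_points R X a Y b. x \<in> U \<and> y \<in> V \<and> fp_value R X a Y b x y U V l \<notin> P} | U V l.
        openin (topol X) U \<and> openin (topol Y) V \<and>
        set l \<subseteq> carrier (sect X U) \<times> carrier (sect Y V)}"

text \<open>
  The diagonal sends \<open>z\<close> to \<open>(z, z, P)\<close> where \<open>P\<close> is the kernel of the multiplication
  \<open>\<kappa>(z) \<otimes>\<^sub>R \<kappa>(z) \<longrightarrow> \<kappa>(z)\<close>, which is generated by the elements \<open>c \<otimes> 1 - 1 \<otimes> c\<close>. The diagonal being
  always an immersion, it is a closed immersion iff its image is closed.
\<close>

definition diag_point where
  "diag_point R X a z = (z, z, Idl\<^bsub>fp_tensor R X a X a z z\<^esub>
     {fp_elt R X a X a z z c \<one>\<^bsub>res_field X z\<^esub> \<ominus>\<^bsub>fp_tensor R X a X a z z\<^esub>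
      fp_elt R X a X a z z \<one>\<^bsub>res_field X z\<^esub> c | c. c \<in> carrier (res_field X z)})"

definition separated_over :: "'a ring \<Rightarrow> ('p, 's) rspace \<Rightarrow> ('a \<Rightarrow> 's) \<Rightarrow> bool" where
  "separated_over R X a \<longleftrightarrow> closedin (fp_top R X a X a) (diag_point R X a ` pts X)"

text \<open>
  Closedness of all base changes to \<open>Spec B\<close>, where \<open>B\<close> runs over the \<open>R\<close>-algebras with elements in a
  type large enough for all finitely generated \<open>R\<close>-algebras. For \<open>X\<close> quasi-compact over \<open>R\<close> closedness
  after base change to the polynomial rings already yields closedness after arbitrary base change.
\<close>

definition universally_closed_over :: "'a ring \<Rightarrow> ('p, 's) rspace \<Rightarrow> ('a \<Rightarrow> 's) \<Rightarrow> bool" where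
  "universally_closed_over R X a \<longleftrightarrow>
     (\<forall>(B :: ((nat \<Rightarrow> nat) \<Rightarrow> 'a) ring) \<beta>. cring B \<and> \<beta> \<in> ring_hom R B \<longrightarrow>
        closed_map (fp_top R X a (Spec B) (\<lambda>r. spec_global B (\<beta> r))) (topol (Spec B))
          (\<lambda>(x, y, P). y))"

definition finite_type_over :: "'a ring \<Rightarrow> ('p, 's) rspace \<Rightarrow> ('a \<Rightarrow> 's) \<Rightarrow> bool" where
  "finite_type_over R X a \<longleftrightarrow> (\<exists>\<U>. finite \<U> \<and> \<Union>\<U> = pts X \<and>
     (\<forall>U\<in>\<U>. affine_open X U \<and>
        (\<exists>S. finite S \<and> S \<subseteq> carrier (sect X U) \<and>
           generate_ring (sect X U) ((\<lambda>r. restr X (pts X) U (a r)) ` carrier R \<union> S) =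
             carrier (sect X U))))"

definition proper_over :: "'a ring \<Rightarrow> ('p, 's) rspace \<Rightarrow> ('a \<Rightarrow> 's) \<Rightarrow> bool" where
  "proper_over R X a \<longleftrightarrow>
     finite_type_over R X a \<and> separated_over R X a \<and> universally_closed_over R X a"

definition restricts_to_iso ::
  "('p, 's) rspace \<Rightarrow> ('q, 't) rspace \<Rightarrow> ('p \<Rightarrow> 'q) \<Rightarrow> ('q set \<Rightarrow> 't \<Rightarrow> 's) \<Rightarrow>
   'p set \<Rightarrow> 'q set \<Rightarrow> bool" where
  "restricts_to_iso X Y f F U V \<longleftrightarrow> openin (topol X) U \<and> openin (topol Y) V \<and>
     lrs_iso (open_subspace X U) (open_subspace Y V) f
       (\<lambda>W t. restr X (preim X f W) (U \<inter> preim X f W) (F W t))"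

definition birational_morphism ::
  "('p, 's) rspace \<Rightarrow> ('q, 't) rspace \<Rightarrow> ('p \<Rightarrow> 'q) \<Rightarrow> ('q set \<Rightarrow> 't \<Rightarrow> 's) \<Rightarrow> bool" where
  "birational_morphism X Y f F \<longleftrightarrow> integral_scheme X \<and> integral_scheme Y \<and> lrs_morphism X Y f F \<and>
     (\<exists>U V. U \<noteq> {} \<and> restricts_to_iso X Y f F U V)"

definition exceptional_set ::
  "('p, 's) rspace \<Rightarrow> ('q, 't) rspace \<Rightarrow> ('p \<Rightarrow> 'q) \<Rightarrow> ('q set \<Rightarrow> 't \<Rightarrow> 's) \<Rightarrow> 'p set" where
  "exceptional_set X Y f F = {x \<in> pts X. \<not> (\<exists>U V. x \<in> U \<and> restricts_to_iso X Y f F U V)}"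


section \<open>Divisors on integral regular schemes\<close>

definition generic_point :: "('p, 's) rspace \<Rightarrow> 'p" where
  "generic_point X = (THE x. x \<in> pts X \<and> topol X closure_of {x} = pts X)"

definition fun_field :: "('p, 's) rspace \<Rightarrow> ('p set \<times> 's) set ring" where
  "fun_field X = stalk X (generic_point X)"

definition to_fun_field :: "('p, 's) rspace \<Rightarrow> 'p set \<Rightarrow> 's \<Rightarrow> ('p set \<times> 's) set" where
  "to_fun_field X U s = germ X (generic_point X) U s"

definition stalk_to_fun_field :: "('p, 's) rspace \<Rightarrow> ('p set \<times> 's) set \<Rightarrow> ('p set \<times> 's) set" where
  "stalk_to_fun_field X a = (\<Union>p\<in>a. let (U, s) = p in to_fun_field X U s)"

text \<open>Prime divisors are represented by their generic points.\<close>

definition codim1_points :: "('p, 's) rspace \<Rightarrow> 'p set" where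
  "codim1_points X = {x \<in> pts X. krull_dim (stalk X x) = 1}"

definition local_order :: "'a ring \<Rightarrow> 'a \<Rightarrow> nat" where
  "local_order A a = (GREATEST n. a \<in> ideal_pow A (max_id A) n)"

text \<open>\<open>f = 0\<close> or \<open>ord\<^sub>x f \<ge> k\<close>, where \<open>ord\<^sub>x (a/b) = ord\<^sub>x a - ord\<^sub>x b\<close>.\<close>

definition ord_ge :: "('p, 's) rspace \<Rightarrow> 'p \<Rightarrow> ('p set \<times> 's) set \<Rightarrow> int \<Rightarrow> bool" where
  "ord_ge X x f k \<longleftrightarrow> (\<exists>a\<in>carrier (stalk X x). \<exists>b\<in>carrier (stalk X x). b \<noteq> \<zero>\<^bsub>stalk X x\<^esub> \<and>
     f \<otimes>\<^bsub>fun_field X\<^esub> stalk_to_fun_field X b = stalk_to_fun_field X a \<and>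
     (a = \<zero>\<^bsub>stalk X x\<^esub> \<or> int (local_order (stalk X x) a) - int (local_order (stalk X x) b) \<ge> k))"

definition weil_divisor :: "('p, 's) rspace \<Rightarrow> ('p \<Rightarrow> int) \<Rightarrow> bool" where
  "weil_divisor X E \<longleftrightarrow> finite {x. E x \<noteq> 0} \<and> {x. E x \<noteq> 0} \<subseteq> codim1_points X"

definition div_support :: "('p, 's) rspace \<Rightarrow> ('p \<Rightarrow> int) \<Rightarrow> 'p set" where
  "div_support X E = (\<Union>x\<in>{x. E x \<noteq> 0}. topol X closure_of {x})"

definition div_floor :: "real \<Rightarrow> ('p \<Rightarrow> int) \<Rightarrow> 'p \<Rightarrow> int" where
  "div_floor t E x = \<lfloor>t * real_of_int (E x)\<rfloor>"

record ('p, 's, 'm) msheaf =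
  msect :: "'p set \<Rightarrow> ('s, 'm) module"
  mrestr :: "'p set \<Rightarrow> 'p set \<Rightarrow> 'm \<Rightarrow> 'm"

text \<open>
  The sheaf \<open>O\<^sub>X(E)\<close> as a subsheaf of the constant sheaf with value the function field; the sections
  over the empty set are zero.
\<close>

definition div_sheaf ::
  "('p, 's) rspace \<Rightarrow> ('p \<Rightarrow> int) \<Rightarrow> ('p, 's, ('p set \<times> 's) set) msheaf" where
  "div_sheaf X E = (let K = fun_field X in
     \<lparr>msect = (\<lambda>U.
        \<lparr>carrier = (if U = {} then {\<zero>\<^bsub>K\<^esub>}
            else {f \<in> carrier K. \<forall>x \<in> codim1_points X \<inter> U. ord_ge X x f (- E x)}),
         monoid.mult = undefined, monoid.one = undefined,
         ring.zero = \<zero>\<^bsub>K\<^esub>,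
         ring.add = (\<lambda>f g. f \<oplus>\<^bsub>K\<^esub> g),
         smult = (\<lambda>s f. if U = {} then \<zero>\<^bsub>K\<^esub> else to_fun_field X U s \<otimes>\<^bsub>K\<^esub> f)\<rparr>),
      mrestr = (\<lambda>U V f. if V = {} then \<zero>\<^bsub>K\<^esub> else f)\<rparr>)"

text \<open>\<open>\<aa> O\<^sub>X = O\<^sub>X(-E)\<close>, as subsheaves of the constant sheaf with value the function field.\<close>

definition extended_ideal_is ::
  "('p, 's) rspace \<Rightarrow> ('a \<Rightarrow> 's) \<Rightarrow> 'a set \<Rightarrow> ('p \<Rightarrow> int) \<Rightarrow> bool" where
  "extended_ideal_is X a \<aa> E \<longleftrightarrow> (\<forall>U. openin (topol X) U \<and> U \<noteq> {} \<longrightarrow>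
     to_fun_field X U ` {s \<in> carrier (sect X U).
       \<forall>x\<in>U. germ X x U s \<in> Idl\<^bsub>stalk X x\<^esub> ((\<lambda>r. germ X x (pts X) (a r)) ` \<aa>)} =
     carrier (msect (div_sheaf X (\<lambda>x. - E x)) U))"

definition vanishing_ideal_at :: "('p, 's) rspace \<Rightarrow> 'p set \<Rightarrow> 'p \<Rightarrow> ('p set \<times> 's) set set" where
  "vanishing_ideal_at X E x = {germ X x U s | U s.
     openin (topol X) U \<and> x \<in> U \<and> s \<in> carrier (sect X U) \<and>
     (\<forall>w \<in> U \<inter> E. germ X w U s \<in> max_id (stalk X w))}"

text \<open>
  \<open>E\<close>, with its reduced structure, is a divisor with simple normal crossings: locally at each of its
  points it is cut out by the product of a nonempty part of a regular system of parameters of the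
  (Zariski) local ring.
\<close>

definition snc_set :: "('p, 's) rspace \<Rightarrow> 'p set \<Rightarrow> bool" where
  "snc_set X E \<longleftrightarrow> closedin (topol X) E \<and>
     (\<forall>x\<in>E. \<exists>T T'. reg_sys_params (stalk X x) T \<and> T' \<subseteq> T \<and> T' \<noteq> {} \<and>
        vanishing_ideal_at X E x = PIdl\<^bsub>stalk X x\<^esub> (\<Otimes>\<^bsub>stalk X x\<^esub> c\<in>T'. c))"

text \<open>Closed of pure codimension one, i.e. the support of a divisor.\<close>

definition divisorial_set :: "('p, 's) rspace \<Rightarrow> 'p set \<Rightarrow> bool" where
  "divisorial_set X E \<longleftrightarrow> closedin (topol X) E \<and>
     (\<forall>x\<in>E. (\<forall>w\<in>E. x \<in> topol X closure_of {w} \<longrightarrow> w = x) \<longrightarrow> x \<in> codim1_points X)"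

definition log_resolution ::
  "'a ring \<Rightarrow> 'a set \<Rightarrow> ('p, 's) rspace \<Rightarrow> ('p \<Rightarrow> 'a set) \<Rightarrow>
   ('a set set \<Rightarrow> ('a set \<Rightarrow> ('a \<times> 'a) set) \<Rightarrow> 's) \<Rightarrow> ('p \<Rightarrow> int) \<Rightarrow> bool" where
  "log_resolution R \<aa> Z \<pi> \<phi> D \<longleftrightarrow>
     integral_scheme Z \<and> nonsingular Z \<and> lrs_morphism Z (Spec R) \<pi> \<phi> \<and>
     proper_over R Z (structure_hom R \<phi>) \<and> birational_morphism Z (Spec R) \<pi> \<phi> \<and>
     weil_divisor Z D \<and> extended_ideal_is Z (structure_hom R \<phi>) \<aa> D \<and>
     snc_set Z (div_support Z D) \<and>
     divisorial_set Z (exceptional_set Z (Spec R) \<pi> \<phi>) \<and>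
     snc_set Z (exceptional_set Z (Spec R) \<pi> \<phi> \<union> div_support Z D)"


section \<open>Derived global sections\<close>

definition sheaf_of_modules :: "('p, 's) rspace \<Rightarrow> ('p, 's, 'm) msheaf \<Rightarrow> bool" where
  "sheaf_of_modules X F \<longleftrightarrow>
     (\<forall>U. openin (topol X) U \<longrightarrow> Module.module (sect X U) (msect F U)) \<and>
     (\<forall>U V x y. openin (topol X) U \<and> openin (topol X) V \<and> V \<subseteq> U \<and>
        x \<in> carrier (msect F U) \<and> y \<in> carrier (msect F U) \<longrightarrow>
        mrestr F U V (x \<oplus>\<^bsub>msect F U\<^esub> y) = mrestr F U V x \<oplus>\<^bsub>msect F V\<^esub> mrestr F U V y) \<and>
     (\<forall>U V s x. openin (topol X) U \<and> openin (topol X) V \<and> V \<subseteq> U \<and>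
        s \<in> carrier (sect X U) \<and> x \<in> carrier (msect F U) \<longrightarrow>
        mrestr F U V (s \<odot>\<^bsub>msect F U\<^esub> x) = restr X U V s \<odot>\<^bsub>msect F V\<^esub> mrestr F U V x) \<and>
     sheaf_of_sets (topol X) (\<lambda>U. carrier (msect F U)) (mrestr F)"

definition msheaf_hom ::
  "('p, 's) rspace \<Rightarrow> ('p, 's, 'm) msheaf \<Rightarrow> ('p, 's, 'n) msheaf \<Rightarrow> ('p set \<Rightarrow> 'm \<Rightarrow> 'n) \<Rightarrow> bool" where
  "msheaf_hom X F G \<phi> \<longleftrightarrow>
     (\<forall>U. openin (topol X) U \<longrightarrow> \<phi> U \<in> mod_hom (sect X U) (msect F U) (msect G U)) \<and>
     (\<forall>U V x. openin (topol X) U \<and> openin (topol X) V \<and> V \<subseteq> U \<and> x \<in> carrier (msect F U) \<longrightarrow>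
        \<phi> V (mrestr F U V x) = mrestr G U V (\<phi> U x))"

text \<open>
  Injective objects of the category of \<open>O\<^sub>X\<close>-modules. The lifting property is tested on \<open>O\<^sub>X\<close>-modules
  with sections in the type of those of \<open>O\<^sub>X\<close>; by Baer's criterion for Grothendieck categories this
  suffices, because the subsheaves of the generators \<open>j\<^sub>! O\<^sub>U\<close> are among them.
\<close>

definition injective_msheaf :: "('p, 's) rspace \<Rightarrow> ('p, 's, 'm) msheaf \<Rightarrow> bool" where
  "injective_msheaf X E \<longleftrightarrow> sheaf_of_modules X E \<and>
     (\<forall>(F :: ('p, 's, 's) msheaf) (G :: ('p, 's, 's) msheaf) i f.
        sheaf_of_modules X F \<and> sheaf_of_modules X G \<and>
        msheaf_hom X F G i \<and>
        (\<forall>U. openin (topol X) U \<longrightarrow> inj_on (i U) (carrier (msect F U))) \<and>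
        msheaf_hom X F E f \<longrightarrow>
        (\<exists>g. msheaf_hom X G E g \<and>
           (\<forall>U. openin (topol X) U \<longrightarrow> (\<forall>x\<in>carrier (msect F U). g U (i U x) = f U x))))"

text \<open>Exactness of \<open>F \<longrightarrow> G \<longrightarrow> H\<close> at \<open>G\<close>, as sheaves.\<close>

definition exact_msheaves where
  "exact_msheaves X F \<phi> G \<psi> H \<longleftrightarrow>
     (\<forall>U. openin (topol X) U \<longrightarrow> (\<forall>x\<in>carrier (msect F U). \<psi> U (\<phi> U x) = \<zero>\<^bsub>msect H U\<^esub>) \<and>
       (\<forall>y\<in>carrier (msect G U). \<psi> U y = \<zero>\<^bsub>msect H U\<^esub> \<longrightarrow>
         (\<forall>p\<in>U. \<exists>V. openin (topol X) V \<and> p \<in> V \<and> V \<subseteq> U \<and>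
           (\<exists>x\<in>carrier (msect F V). \<phi> V x = mrestr G U V y))))"

record ('p, 's, 'f, 'm) resolution =
  aug :: "'p set \<Rightarrow> 'f \<Rightarrow> 'm"
  trm :: "nat \<Rightarrow> ('p, 's, 'm) msheaf"
  rdiff :: "nat \<Rightarrow> 'p set \<Rightarrow> 'm \<Rightarrow> 'm"

definition injective_resolution ::
  "('p, 's) rspace \<Rightarrow> ('p, 's, 'f) msheaf \<Rightarrow> ('p, 's, 'f, 'm) resolution \<Rightarrow> bool" where
  "injective_resolution X F I \<longleftrightarrow>
     (\<forall>n. injective_msheaf X (trm I n)) \<and>
     msheaf_hom X F (trm I 0) (aug I) \<and>
     (\<forall>n. msheaf_hom X (trm I n) (trm I (Suc n)) (rdiff I n)) \<and>
     (\<forall>U. openin (topol X) U \<longrightarrow> inj_on (aug I U) (carrier (msect F U))) \<and>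
     exact_msheaves X F (aug I) (trm I 0) (rdiff I 0) (trm I 1) \<and>
     (\<forall>n. exact_msheaves X (trm I n) (rdiff I n) (trm I (Suc n)) (rdiff I (Suc n))
            (trm I (Suc (Suc n))))"

text \<open>
  \<open>R\<Gamma>(X, F)\<close> as a complex of \<open>R\<close>-modules, computed from an injective resolution \<open>I\<close> of \<open>F\<close>;
  \<open>a : R \<longrightarrow> \<Gamma>(X, O\<^sub>X)\<close> is the structure homomorphism.
\<close>

definition R_Gamma ::
  "('p, 's) rspace \<Rightarrow> ('a \<Rightarrow> 's) \<Rightarrow> ('p, 's, 'f, 'm) resolution \<Rightarrow> ('a, 'm) cplx" where
  "R_Gamma X a I =
     \<lparr>obj = (\<lambda>i. if 0 \<le> i then restrict_scalars a (msect (trm I (nat i)) (pts X))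
                 else zero_mod (restrict_scalars a (msect (trm I 0) (pts X)))),
      diff = (\<lambda>i x. if 0 \<le> i then rdiff I (nat i) (pts X) x
                    else \<zero>\<^bsub>msect (trm I 0) (pts X)\<^esub>)\<rparr>"

text \<open>
  \<open>R \<longrightarrow> R\<Gamma>(Z, O\<^sub>Z) \<longrightarrow> R\<Gamma>(Z, O\<^sub>Z(E))\<close> for effective \<open>E\<close>: it is represented by the composite
  \<open>R \<longrightarrow> \<Gamma>(Z, O\<^sub>Z) \<longrightarrow> \<Gamma>(Z, O\<^sub>Z(E)) \<longrightarrow> \<Gamma>(Z, I\<^sup>0)\<close>.
\<close>

definition R_to_R_Gamma ::
  "('p, 's) rspace \<Rightarrow> ('a \<Rightarrow> 's) \<Rightarrow> ('p, 's, ('p set \<times> 's) set, 'm) resolution \<Rightarrow> 'a \<Rightarrow> 'm" where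
  "R_to_R_Gamma Z a I r = aug I (pts Z) (to_fun_field Z (pts Z) (a r))"


section \<open>The threshold\<close>

text \<open>
  \<open>a : R \<longrightarrow> \<Gamma>(Z, O\<^sub>Z)\<close> is the structure homomorphism of the log resolution, and \<open>I t\<close> is an injective
  resolution of \<open>O\<^sub>Z(\<lfloor>tD\<rfloor>)\<close>.
\<close>

definition c_KH ::
  "'a ring \<Rightarrow> ('p, 's) rspace \<Rightarrow> ('a \<Rightarrow> 's) \<Rightarrow>
   (real \<Rightarrow> ('p, 's, ('p set \<times> 's) set, 'm) resolution) \<Rightarrow> 'a list \<Rightarrow> ereal" where
  "c_KH R Z a I xs = Inf {ereal t | t. 0 \<le> t \<and>
     zero_in_derived_cat R (ring_cplx R)
       (tensor_cplx R (koszul R xs) (R_Gamma Z a (I t)))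
       (koszul_unit R xs (R_Gamma Z a (I t)) (R_to_R_Gamma Z a (I t)))}"

end

theory Submission
  imports Defs
begin

text \<open>
  If \<open>(x) \<subseteq> (y)\<close>, there is a chain map \<open>Kos(x) \<longrightarrow> Kos(y)\<close> carrying \<open>1\<close> to \<open>1\<close>. Tensoring it with
  \<open>M = R\<Gamma>(Z, O\<^sub>Z(\<lfloor>tD\<rfloor>))\<close> gives a map that carries \<open>R \<longrightarrow> Kos(x) \<otimes> M\<close> to \<open>R \<longrightarrow> Kos(y) \<otimes> M\<close>, so
  the latter vanishes in the derived category whenever the former does. By symmetry the infima defining
  the two thresholds range over the same set.

  The chain map is built by recursion on \<open>x\<close>: the elements of \<open>R\<close> that act on \<open>Kos(y)\<close> null-homotopically
  form an ideal, which contains each \<open>y\<^sub>i\<close> by way of exterior multiplication with \<open>e\<^sub>i\<close>. Hence every entry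
  of \<open>x\<close> acts null-homotopically, and the null-homotopies say where to send the basis vectors.
\<close>

section \<open>Free modules\<close>

text \<open>So neither comparison map can be expected to be an isomorphism, and the argument uses
  one map in each direction together with the fact that it carries unit to unit. The classical
  comparison map is the exterior algebra of a matrix that expresses \<open>x\<close> through
  \<open>y\<close>, with minors as entries. The recursion replaces the matrix by homotopies: putting
  \<open>x\<close> in front of \<open>xs\<close> turns \<open>Kos(xs)\<close> into the mapping cone
  of multiplication by \<open>x\<close>, and a chain map out of a cone is a chain map on the base
  together with a null-homotopy of its composite with \<open>x\<close>. No coefficients are ever
  chosen. Postcomposition is the harmless direction in the derived category: the quasi-isomorphism
  into \<open>R\<close> that witnesses vanishing is kept, and the null-homotopy is composed. What
  remains is functoriality of the tensor product; as tensors are classes of finitely supported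
  functions on pairs, it comes down to moving coefficients along a map of pairs.\<close>

locale base_ring = cring R for R :: "'a ring" (structure)
begin

lemma free_mod_simps [simp]:
  "h \<oplus>\<^bsub>free_mod R X\<^esub> k = (\<lambda>p. h p \<oplus> k p)"
  "\<zero>\<^bsub>free_mod R X\<^esub> = (\<lambda>_. \<zero>)"
  "r \<odot>\<^bsub>free_mod R X\<^esub> h = (\<lambda>p. r \<otimes> h p)"
  by (simp_all add: free_mod_def)

lemma mem_free_mod:
  "h \<in> carrier (free_mod R X) \<longleftrightarrow>
     (\<forall>p. h p \<in> carrier R) \<and> finite {p. h p \<noteq> \<zero>} \<and> (\<forall>p. h p \<noteq> \<zero> \<longrightarrow> p \<in> X)"
  by (auto simp: free_mod_def fun_supp_def)

lemma free_mod_closed: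
  assumes "h \<in> carrier (free_mod R X)"
  shows "h p \<in> carrier R"
  using assms by (simp add: mem_free_mod)

lemma free_mod_add:
  assumes "h \<in> carrier (free_mod R X)" "k \<in> carrier (free_mod R X)"
  shows "(\<lambda>p. h p \<oplus> k p) \<in> carrier (free_mod R X)"
proof -
  have "{p. h p \<oplus> k p \<noteq> \<zero>} \<subseteq> {p. h p \<noteq> \<zero>} \<union> {p. k p \<noteq> \<zero>}"
    using assms by (auto simp: mem_free_mod)
  then show ?thesis
    using assms by (auto simp: mem_free_mod intro: finite_subset)
qed

lemma free_mod_smult:
  assumes "r \<in> carrier R" "h \<in> carrier (free_mod R X)"
  shows "(\<lambda>p. r \<otimes> h p) \<in> carrier (free_mod R X)"
proof -
  have "{p. r \<otimes> h p \<noteq> \<zero>} \<subseteq> {p. h p \<noteq> \<zero>}"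
    using assms by (auto simp: mem_free_mod)
  then show ?thesis
    using assms by (auto simp: mem_free_mod intro: finite_subset)
qed

lemma free_mod_uminus:
  assumes "h \<in> carrier (free_mod R X)"
  shows "(\<lambda>p. \<ominus> h p) \<in> carrier (free_mod R X)"
proof -
  have "{p. \<ominus> h p \<noteq> \<zero>} \<subseteq> {p. h p \<noteq> \<zero>}"
    using assms by (auto simp: mem_free_mod)
  then show ?thesis
    using assms by (auto simp: mem_free_mod intro: finite_subset)
qed

lemma free_mod_zero: "(\<lambda>_. \<zero>) \<in> carrier (free_mod R X)"
  by (simp add: mem_free_mod)

lemma free_mod_single: "x \<in> X \<Longrightarrow> single R x \<in> carrier (free_mod R X)"
  by (simp add: mem_free_mod single_def)

lemma free_mod_UNIV: "h \<in> carrier (free_mod R X) \<Longrightarrow> h \<in> carrier (free_mod R UNIV)"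
  by (simp add: mem_free_mod)

lemma free_mod_module: "module R (free_mod R X)"
proof (rule moduleI[OF is_cring])
  show "abelian_group (free_mod R X)"
  proof (rule abelian_groupI)
    fix h assume "h \<in> carrier (free_mod R X)"
    then show "\<exists>k\<in>carrier (free_mod R X). k \<oplus>\<^bsub>free_mod R X\<^esub> h = \<zero>\<^bsub>free_mod R X\<^esub>"
      using free_mod_uminus free_mod_closed[of h X]
      by (intro bexI[of _ "\<lambda>p. \<ominus> h p"]) (auto simp: l_neg)
  qed (auto simp: free_mod_add free_mod_zero free_mod_closed a_ac)
qed (auto simp: free_mod_smult free_mod_closed l_distr r_distr m_assoc)

lemma free_mod_abelian_group: "abelian_group (free_mod R X)"
  using free_mod_module by (rule module.axioms)

lemma free_mod_a_inv [simp]: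
  assumes "h \<in> carrier (free_mod R X)"
  shows "\<ominus>\<^bsub>free_mod R X\<^esub> h = (\<lambda>p. \<ominus> h p)"
proof -
  interpret F: abelian_group "free_mod R X" by (rule free_mod_abelian_group)
  show ?thesis
    using assms by (intro F.minus_equality) (auto simp: free_mod_uminus free_mod_closed l_neg)
qed

lemma free_mod_minus [simp]:
  assumes "k \<in> carrier (free_mod R X)"
  shows "h \<ominus>\<^bsub>free_mod R X\<^esub> k = (\<lambda>p. h p \<ominus> k p)"
  using assms by (simp add: a_minus_def)

text \<open>Removing one point of the support at a time reduces identities between linear maps to
  basis vectors, without having to write \<open>h\<close> as a finite sum.\<close>

lemma free_mod_induct [consumes 1, case_names zero add]:
  assumes h: "h \<in> carrier (free_mod R X)"
    and zero: "P (\<lambda>_. \<zero>)"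
    and add: "\<And>r x k. r \<in> carrier R \<Longrightarrow> x \<in> X \<Longrightarrow> k \<in> carrier (free_mod R X) \<Longrightarrow> P k \<Longrightarrow>
                P (\<lambda>p. r \<otimes> single R x p \<oplus> k p)"
  shows "P h"
proof -
  have "finite {p. h p \<noteq> \<zero>}" using h by (simp add: mem_free_mod)
  then show ?thesis using h
  proof (induction "{p. h p \<noteq> \<zero>}" arbitrary: h rule: finite_induct)
    case empty
    then have "h = (\<lambda>_. \<zero>)" by auto
    with zero show ?case by simp
  next
    case (insert x F)
    define k where "k = h(x := \<zero>)"
    have F: "F = {p. k p \<noteq> \<zero>}"
      using insert.hyps by (auto simp: k_def)
    have k: "k \<in> carrier (free_mod R X)"
      using insert.prems F insert.hyps(1) by (auto simp: mem_free_mod k_def)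
    have "P (\<lambda>p. h x \<otimes> single R x p \<oplus> k p)"
      using insert.hyps(4) insert.prems
      by (intro add insert.hyps(3)[OF F k] k) (auto simp: mem_free_mod)
    moreover have "(\<lambda>p. h x \<otimes> single R x p \<oplus> k p) = h"
      using insert.prems by (auto simp: k_def single_def mem_free_mod)
    ultimately show ?case by simp
  qed
qed

end

text \<open>This is the map of free modules that \<open>f\<close> induces on basis vectors, isolated
  from the body of \<open>tensor_map\<close>. Summing over the support keeps the sum finite even
  where \<open>f\<close> has infinite fibres.\<close>

definition pushforward :: "'a ring \<Rightarrow> ('x \<Rightarrow> 'y) \<Rightarrow> ('x \<Rightarrow> 'a) \<Rightarrow> 'y \<Rightarrow> 'a" where
  "pushforward R f h = (\<lambda>q. \<Oplus>\<^bsub>R\<^esub> p \<in> {p \<in> fun_supp R h. f p = q}. h p)"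

context base_ring
begin

text \<open>Two functions have different supports; on a common finite superset their sums can be
  compared term by term. This is what additivity of \<open>pushforward\<close> rests on.\<close>

lemma pushforward_eq:
  assumes "finite A" "{p. h p \<noteq> \<zero>} \<subseteq> A" "\<And>p. h p \<in> carrier R"
  shows "pushforward R f h q = (\<Oplus>p\<in>A. if f p = q then h p else \<zero>)"
  unfolding pushforward_def
  by (rule add.finprod_mono_neutral_cong_left) (use assms in \<open>auto simp: fun_supp_def\<close>)

lemma pushforward_zero [simp]: "pushforward R f (\<lambda>_. \<zero>) = (\<lambda>_. \<zero>)"
  by (simp add: pushforward_def fun_supp_def)

lemma pushforward_single [simp]: "pushforward R f (single R x) = single R (f x)"
proof
  fix q
  have "pushforward R f (single R x) q = (\<Oplus>p\<in>{x}. if f p = q then single R x p else \<zero>)"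
    by (rule pushforward_eq) (auto simp: single_def)
  then show "pushforward R f (single R x) q = single R (f x) q"
    by (auto simp: single_def)
qed

lemma pushforward_add:
  assumes "h \<in> carrier (free_mod R X)" "k \<in> carrier (free_mod R Y)"
  shows "pushforward R f (\<lambda>p. h p \<oplus> k p) = (\<lambda>q. pushforward R f h q \<oplus> pushforward R f k q)"
proof
  fix q
  let ?A = "{p. h p \<noteq> \<zero>} \<union> {p. k p \<noteq> \<zero>}"
  have fin: "finite ?A" and h: "\<And>p. h p \<in> carrier R" and k: "\<And>p. k p \<in> carrier R"
    using assms by (auto simp: mem_free_mod)
  have "pushforward R f (\<lambda>p. h p \<oplus> k p) q = (\<Oplus>p\<in>?A. if f p = q then h p \<oplus> k p else \<zero>)"
    by (rule pushforward_eq) (use fin h k in auto)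
  also have "\<dots> = (\<Oplus>p\<in>?A. (if f p = q then h p else \<zero>) \<oplus> (if f p = q then k p else \<zero>))"
    by (rule add.finprod_cong') (use h k in auto)
  also have "\<dots> = (\<Oplus>p\<in>?A. if f p = q then h p else \<zero>) \<oplus> (\<Oplus>p\<in>?A. if f p = q then k p else \<zero>)"
    by (rule finsum_addf) (use h k in auto)
  also have "\<dots> = pushforward R f h q \<oplus> pushforward R f k q"
    using fin h k by (subst (1 2) pushforward_eq[where A = ?A]) auto
  finally show "pushforward R f (\<lambda>p. h p \<oplus> k p) q = pushforward R f h q \<oplus> pushforward R f k q" .
qed

lemma pushforward_smult:
  assumes "r \<in> carrier R" "h \<in> carrier (free_mod R X)"
  shows "pushforward R f (\<lambda>p. r \<otimes> h p) = (\<lambda>q. r \<otimes> pushforward R f h q)"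
proof
  fix q
  let ?A = "{p. h p \<noteq> \<zero>}"
  have fin: "finite ?A" and h: "\<And>p. h p \<in> carrier R"
    using assms by (auto simp: mem_free_mod)
  have "pushforward R f (\<lambda>p. r \<otimes> h p) q = (\<Oplus>p\<in>?A. if f p = q then r \<otimes> h p else \<zero>)"
    by (rule pushforward_eq) (use fin h assms(1) in auto)
  also have "\<dots> = (\<Oplus>p\<in>?A. r \<otimes> (if f p = q then h p else \<zero>))"
    by (rule add.finprod_cong') (use h assms(1) in auto)
  also have "\<dots> = r \<otimes> (\<Oplus>p\<in>?A. if f p = q then h p else \<zero>)"
    by (rule finsum_rdistr[symmetric]) (use fin h assms(1) in auto)
  also have "\<dots> = r \<otimes> pushforward R f h q"
    using fin h by (subst pushforward_eq[where A = ?A]) auto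
  finally show "pushforward R f (\<lambda>p. r \<otimes> h p) q = r \<otimes> pushforward R f h q" .
qed

lemma pushforward_closed:
  assumes "h \<in> carrier (free_mod R X)" "\<And>x. x \<in> X \<Longrightarrow> f x \<in> Y"
  shows "pushforward R f h \<in> carrier (free_mod R Y)"
  using assms(1)
proof (induction rule: free_mod_induct)
  case zero
  then show ?case by (simp add: free_mod_zero)
next
  case (add r x k)
  then show ?case
    using assms(2)
    by (simp add: pushforward_add[OF free_mod_smult[OF _ free_mod_single] add(3)]
        pushforward_smult[OF _ free_mod_single] free_mod_add free_mod_smult free_mod_single)
qed

lemma pushforward_comp:
  assumes "h \<in> carrier (free_mod R X)" "\<And>x. x \<in> X \<Longrightarrow> g (f x) = k x"
  shows "pushforward R g (pushforward R f h) = pushforward R k h"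
  using assms(1)
proof (induction rule: free_mod_induct)
  case zero
  then show ?case by simp
next
  case (add r x l)
  \<comment> \<open>Where the image lies is immaterial for additivity, so the free module on the
    whole target type is good enough.\<close>
  have "pushforward R f l \<in> carrier (free_mod R UNIV)"
    using add by (intro pushforward_closed) auto
  then show ?case
    using add assms(2)
    by (simp add: pushforward_add[OF free_mod_smult[OF _ free_mod_single] add(3)]
        pushforward_smult[OF _ free_mod_single[of _ UNIV]]
        pushforward_add[OF free_mod_smult[OF _ free_mod_single[of _ UNIV]], where Y=UNIV])
qed

end

section \<open>Tensor products of modules\<close>

lemma mod_homI:
  assumes "\<And>x. x \<in> carrier M \<Longrightarrow> f x \<in> carrier N"
    and "\<And>x y. x \<in> carrier M \<Longrightarrow> y \<in> carrier M \<Longrightarrow> f (x \<oplus>\<^bsub>M\<^esub> y) = f x \<oplus>\<^bsub>N\<^esub> f y"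
    and "\<And>r x. r \<in> carrier R \<Longrightarrow> x \<in> carrier M \<Longrightarrow> f (r \<odot>\<^bsub>M\<^esub> x) = r \<odot>\<^bsub>N\<^esub> f x"
  shows "f \<in> mod_hom R M N"
  using assms by (auto simp: mod_hom_def)

lemma mod_homD:
  assumes "f \<in> mod_hom R M N"
  shows "x \<in> carrier M \<Longrightarrow> f x \<in> carrier N"
    and "x \<in> carrier M \<Longrightarrow> y \<in> carrier M \<Longrightarrow> f (x \<oplus>\<^bsub>M\<^esub> y) = f x \<oplus>\<^bsub>N\<^esub> f y"
    and "r \<in> carrier R \<Longrightarrow> x \<in> carrier M \<Longrightarrow> f (r \<odot>\<^bsub>M\<^esub> x) = r \<odot>\<^bsub>N\<^esub> f x"
  using assms by (auto simp: mod_hom_def)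

lemma id_mod_hom: "(\<lambda>x. x) \<in> mod_hom R M M"
  by (auto intro: mod_homI)

lemma mod_hom_comp:
  assumes "f \<in> mod_hom R M N" "g \<in> mod_hom R N P"
  shows "(\<lambda>x. g (f x)) \<in> mod_hom R M P"
  using mod_homD[OF assms(1)] mod_homD[OF assms(2)] by (intro mod_homI) auto

text \<open>
  The part of the module axioms that the construction of \<open>\<otimes>\<close> relies on. Working with it avoids having to
  show that restriction of scalars along the structure homomorphism yields a module.
\<close>

definition lin_closed :: "'a ring \<Rightarrow> ('a, 'm) module \<Rightarrow> bool" where
  "lin_closed R M \<longleftrightarrow>
     (\<forall>x\<in>carrier M. \<forall>y\<in>carrier M. x \<oplus>\<^bsub>M\<^esub> y \<in> carrier M) \<and>
     (\<forall>r\<in>carrier R. \<forall>x\<in>carrier M. r \<odot>\<^bsub>M\<^esub> x \<in> carrier M)"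

section \<open>Spans\<close>

lemma mod_span_submodule:
  assumes "module R M" "S \<subseteq> carrier M"
  shows "submodule (mod_span R M S) R M"
proof -
  interpret module R M by fact
  \<comment> \<open>The whole module is among the intersected submodules, so the span stays inside
    \<open>carrier M\<close>.\<close>
  have c: "submodule (carrier M) R M" by (rule carrier_is_submodule)
  have zero: "\<zero>\<^bsub>M\<^esub> \<in> N" if "submodule N R M" for N
    using subgroup.one_closed[OF submodule.axioms(1)[OF that]] by simp
  show ?thesis
    by (rule submoduleI) (use c assms(2) zero in \<open>auto simp: mod_span_def submoduleE\<close>)
qed

lemma mod_span_superset: "S \<subseteq> mod_span R M S"
  by (auto simp: mod_span_def)

lemma mod_span_least: "submodule N R M \<Longrightarrow> S \<subseteq> N \<Longrightarrow> mod_span R M S \<subseteq> N"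
  by (auto simp: mod_span_def)

abbreviation tensor_class ::
  "'a ring \<Rightarrow> ('a, 'm) module \<Rightarrow> ('a, 'n) module \<Rightarrow> ('m \<times> 'n \<Rightarrow> 'a) \<Rightarrow> ('m \<times> 'n \<Rightarrow> 'a) set" where
  "tensor_class R M N h \<equiv> tensor_null R M N +>\<^bsub>free_mod R (carrier M \<times> carrier N)\<^esub> h"

context base_ring
begin

lemma pushforward_uminus:
  assumes "h \<in> carrier (free_mod R X)"
  shows "pushforward R f (\<lambda>p. \<ominus> h p) = (\<lambda>q. \<ominus> pushforward R f h q)"
proof -
  have h: "h p \<in> carrier R" for p using assms by (rule free_mod_closed)
  have p: "pushforward R f h q \<in> carrier R" for q
    using pushforward_closed[OF assms, of f UNIV] by (simp add: mem_free_mod)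
  have "(\<lambda>p. \<ominus> h p) = (\<lambda>p. (\<ominus> \<one>) \<otimes> h p)"
    using h by (simp add: l_minus)
  then show ?thesis
    using assms p by (simp add: pushforward_smult[where X = X] l_minus)
qed

lemma pushforward_minus:
  assumes "h \<in> carrier (free_mod R X)" "k \<in> carrier (free_mod R Y)"
  shows "pushforward R f (\<lambda>p. h p \<ominus> k p) = (\<lambda>q. pushforward R f h q \<ominus> pushforward R f k q)"
  unfolding a_minus_def
  using assms by (simp add: pushforward_add[OF assms(1) free_mod_uminus[OF assms(2)]] pushforward_uminus)

lemma tensor_rels_subset:
  assumes "lin_closed R M" "lin_closed R N"
  shows "tensor_rels R M N \<subseteq> carrier (free_mod R (carrier M \<times> carrier N))"
proof -
  let ?F = "free_mod R (carrier M \<times> carrier N)"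
  interpret F: module R ?F by (rule free_mod_module)
  show ?thesis
    using assms unfolding tensor_rels_def Let_def lin_closed_def
    by (auto simp del: free_mod_simps free_mod_minus intro!: F.minus_closed F.add.m_closed F.smult_closed free_mod_single)
qed

lemma tensor_null_submodule:
  assumes "lin_closed R M" "lin_closed R N"
  shows "submodule (tensor_null R M N) R (free_mod R (carrier M \<times> carrier N))"
  unfolding tensor_null_def
  by (rule mod_span_submodule[OF free_mod_module tensor_rels_subset[OF assms]])

lemma tensor_null_abelian_subgroup:
  assumes "lin_closed R M" "lin_closed R N"
  shows "abelian_subgroup (tensor_null R M N) (free_mod R (carrier M \<times> carrier N))"
  using submodule.axioms(1)[OF tensor_null_submodule[OF assms]]
  by (intro abelian_subgroupI3 additive_subgroupI free_mod_abelian_group)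

section \<open>Computing with classes of representatives\<close>

lemma carrier_tensor_mod:
  "carrier (tensor_mod R M N) = tensor_class R M N ` carrier (free_mod R (carrier M \<times> carrier N))"
  by (auto simp: tensor_mod_def quot_mod_def A_RCOSETS_def')

lemma tensor_mod_zero:
  assumes "lin_closed R M" "lin_closed R N"
  shows "\<zero>\<^bsub>tensor_mod R M N\<^esub> = tensor_class R M N (\<lambda>_. \<zero>)"
proof -
  interpret N: abelian_subgroup "tensor_null R M N" "free_mod R (carrier M \<times> carrier N)"
    by (rule tensor_null_abelian_subgroup[OF assms])
  show ?thesis
    using N.a_coset_add_zero[OF N.a_subset] by (simp add: tensor_mod_def quot_mod_def)
qed

lemma tensor_mod_add:
  assumes "lin_closed R M" "lin_closed R N"
    and "h \<in> carrier (free_mod R (carrier M \<times> carrier N))"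
    and "k \<in> carrier (free_mod R (carrier M \<times> carrier N))"
  shows "tensor_class R M N h \<oplus>\<^bsub>tensor_mod R M N\<^esub> tensor_class R M N k =
    tensor_class R M N (\<lambda>p. h p \<oplus> k p)"
proof -
  interpret N: abelian_subgroup "tensor_null R M N" "free_mod R (carrier M \<times> carrier N)"
    by (rule tensor_null_abelian_subgroup[OF assms(1,2)])
  show ?thesis
    using N.a_rcos_sum[OF assms(3,4)] by (simp add: tensor_mod_def quot_mod_def)
qed

text \<open>Addition of functions does not depend on the index set, so the coset can be computed in
  the free module on all pairs. Admitting such \<open>h\<close> later allows an elementary tensor to
  be mapped without knowing that its entries lie in the two modules.\<close>

lemma tensor_class_absorb:
  assumes "lin_closed R M" "lin_closed R N"
    and "n \<in> tensor_null R M N" "h \<in> carrier (free_mod R UNIV)"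
  shows "tensor_class R M N (\<lambda>p. n p \<oplus> h p) = tensor_class R M N h"
proof -
  let ?F = "free_mod R (carrier M \<times> carrier N)" and ?U = "free_mod R (UNIV :: ('b \<times> 'c) set)"
  interpret N: abelian_subgroup "tensor_null R M N" ?F
    by (rule tensor_null_abelian_subgroup[OF assms(1,2)])
  interpret U: abelian_group ?U by (rule free_mod_abelian_group)
  have sub: "tensor_null R M N \<subseteq> carrier ?U"
    using N.a_subset free_mod_UNIV by blast
  have same: "A +>\<^bsub>?F\<^esub> x = A +>\<^bsub>?U\<^esub> x" for A x
    by (simp add: a_r_coset_def')
  have "tensor_class R M N n = tensor_null R M N"
    using assms(3) by (rule N.a_rcos_const)
  then have "tensor_class R M N h = (tensor_null R M N +>\<^bsub>?U\<^esub> n) +>\<^bsub>?U\<^esub> h"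
    by (simp add: same)
  also have "\<dots> = tensor_null R M N +>\<^bsub>?U\<^esub> (n \<oplus>\<^bsub>?U\<^esub> h)"
    using sub assms(3,4) by (intro U.a_coset_add_assoc) auto
  finally show ?thesis
    by (simp add: same)
qed

lemma tensor_mod_smult:
  assumes "lin_closed R M" "lin_closed R N" "r \<in> carrier R"
    and "h \<in> carrier (free_mod R (carrier M \<times> carrier N))"
  shows "r \<odot>\<^bsub>tensor_mod R M N\<^esub> tensor_class R M N h = tensor_class R M N (\<lambda>p. r \<otimes> h p)"
proof -
  let ?F = "free_mod R (carrier M \<times> carrier N)"
  interpret N: abelian_subgroup "tensor_null R M N" ?F
    by (rule tensor_null_abelian_subgroup[OF assms(1,2)])
  \<comment> \<open>Scalar multiplication on the quotient is a union over all members of the class.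
    It collapses because every member gives the same class and there is at least one member.\<close>
  have "tensor_class R M N (\<lambda>p. r \<otimes> k p) = tensor_class R M N (\<lambda>p. r \<otimes> h p)"
    if "k \<in> tensor_class R M N h" for k
  proof -
    from that obtain n where n: "n \<in> tensor_null R M N" and k: "k = (\<lambda>p. n p \<oplus> h p)"
      by (auto simp: a_r_coset_def')
    have "(\<lambda>p. r \<otimes> n p) \<in> tensor_null R M N"
      using submodule.smult_closed[OF tensor_null_submodule[OF assms(1,2)] assms(3) n] by simp
    moreover have "(\<lambda>p. r \<otimes> k p) = (\<lambda>p. (r \<otimes> n p) \<oplus> (r \<otimes> h p))"
      using assms n N.a_subset by (auto simp: k r_distr mem_free_mod subset_iff)
    ultimately show ?thesis
      using tensor_class_absorb assms(1-3) free_mod_smult[OF assms(3) free_mod_UNIV[OF assms(4)]] by simp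
  qed
  moreover have "tensor_class R M N h \<noteq> {}"
    using N.a_rcos_self[OF assms(4)] by auto
  ultimately show ?thesis
    by (auto simp: tensor_mod_def quot_mod_def)
qed

lemma tensor_mod_minus:
  assumes "lin_closed R M" "lin_closed R N"
    and "h \<in> carrier (free_mod R (carrier M \<times> carrier N))"
    and "k \<in> carrier (free_mod R (carrier M \<times> carrier N))"
  shows "tensor_class R M N h \<ominus>\<^bsub>tensor_mod R M N\<^esub> tensor_class R M N k =
    tensor_class R M N (\<lambda>p. h p \<ominus> k p)"
proof -
  let ?T = "tensor_mod R M N" and ?F = "free_mod R (carrier M \<times> carrier N)"
  note add = tensor_mod_add[OF assms(1,2)] and zero = tensor_mod_zero[OF assms(1,2)]
  \<comment> \<open>Subtraction in a record goes through the inverse of its additive monoid, so it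
    can be evaluated only once that monoid is known to be a group.\<close>
  interpret T: abelian_group ?T
  proof (rule abelian_groupI)
    show "\<zero>\<^bsub>?T\<^esub> \<in> carrier ?T"
      by (auto simp: zero carrier_tensor_mod free_mod_zero)
  next
    fix x assume "x \<in> carrier ?T"
    then obtain h where h: "h \<in> carrier ?F" "x = tensor_class R M N h"
      by (auto simp: carrier_tensor_mod)
    have "tensor_class R M N (\<lambda>p. \<ominus> h p) \<oplus>\<^bsub>?T\<^esub> x = \<zero>\<^bsub>?T\<^esub>"
      using h by (simp add: add zero free_mod_uminus free_mod_closed[OF h(1)] l_neg)
    with h show "\<exists>y\<in>carrier ?T. y \<oplus>\<^bsub>?T\<^esub> x = \<zero>\<^bsub>?T\<^esub>"
      by (auto simp: carrier_tensor_mod free_mod_uminus)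
  qed (auto simp: add zero carrier_tensor_mod free_mod_add free_mod_zero free_mod_closed a_ac)
  have "\<ominus>\<^bsub>?T\<^esub> tensor_class R M N k = tensor_class R M N (\<lambda>p. \<ominus> k p)"
    using assms by (intro T.minus_equality)
      (auto simp: add zero carrier_tensor_mod free_mod_uminus free_mod_closed[OF assms(4)] l_neg)
  then show ?thesis
    using assms by (simp add: a_minus_def add free_mod_uminus)
qed

section \<open>Functoriality of the tensor product\<close>

lemma tensor_map_eq_pushforward:
  "tensor_map R M' N' f g X =
     (\<Union>h\<in>X. tensor_class R M' N' (pushforward R (\<lambda>p. (f (fst p), g (snd p))) h))"
  by (simp add: tensor_map_def pushforward_def)

text \<open>This is the shape shared by the two additivity relations in \<open>tensor_rels\<close>;
  \<open>pushforward_single_minus_smult\<close> treats the shape of the two scalar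
  relations.\<close>

lemma pushforward_single_minus_add:
  assumes "x \<in> X" "y \<in> X" "z \<in> X" "f x \<in> Y" "f y \<in> Y" "f z \<in> Y"
  shows "pushforward R f (single R x \<ominus>\<^bsub>free_mod R X\<^esub> (single R y \<oplus>\<^bsub>free_mod R X\<^esub> single R z)) =
    single R (f x) \<ominus>\<^bsub>free_mod R Y\<^esub> (single R (f y) \<oplus>\<^bsub>free_mod R Y\<^esub> single R (f z))"
  using assms
  by (simp add: free_mod_single free_mod_add pushforward_minus[of _ X _ X] pushforward_add[of _ X _ X])

lemma pushforward_single_minus_smult:
  assumes "r \<in> carrier R" "x \<in> X" "y \<in> X" "f x \<in> Y" "f y \<in> Y"
  shows "pushforward R f (single R x \<ominus>\<^bsub>free_mod R X\<^esub> (r \<odot>\<^bsub>free_mod R X\<^esub> single R y)) =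
    single R (f x) \<ominus>\<^bsub>free_mod R Y\<^esub> (r \<odot>\<^bsub>free_mod R Y\<^esub> single R (f y))"
  using assms
  by (simp add: free_mod_single free_mod_smult pushforward_minus[of _ X _ X] pushforward_smult[of _ _ X])

text \<open>Linearity of \<open>f\<close> and \<open>g\<close> turns each generating relation into a
  relation of the same kind.\<close>

lemma pushforward_tensor_rels:
  assumes cl: "lin_closed R M" "lin_closed R N"
    and f: "f \<in> mod_hom R M M'" and g: "g \<in> mod_hom R N N'"
    and h: "h \<in> tensor_rels R M N"
  shows "pushforward R (\<lambda>p. (f (fst p), g (snd p))) h \<in> tensor_rels R M' N'"
proof -
  let ?p = "\<lambda>p. (f (fst p), g (snd p))"
  let ?F = "free_mod R (carrier M \<times> carrier N)" and ?F' = "free_mod R (carrier M' \<times> carrier N')"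
  note f = mod_homD[OF f] and g = mod_homD[OF g]
  from h consider
    (l) m m' n where "h = single R (m \<oplus>\<^bsub>M\<^esub> m', n) \<ominus>\<^bsub>?F\<^esub> (single R (m, n) \<oplus>\<^bsub>?F\<^esub> single R (m', n))"
      "m \<in> carrier M" "m' \<in> carrier M" "n \<in> carrier N"
  | (r) m n n' where "h = single R (m, n \<oplus>\<^bsub>N\<^esub> n') \<ominus>\<^bsub>?F\<^esub> (single R (m, n) \<oplus>\<^bsub>?F\<^esub> single R (m, n'))"
      "m \<in> carrier M" "n \<in> carrier N" "n' \<in> carrier N"
  | (sl) r m n where "h = single R (r \<odot>\<^bsub>M\<^esub> m, n) \<ominus>\<^bsub>?F\<^esub> (r \<odot>\<^bsub>?F\<^esub> single R (m, n))"
      "r \<in> carrier R" "m \<in> carrier M" "n \<in> carrier N"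
  | (sr) r m n where "h = single R (m, r \<odot>\<^bsub>N\<^esub> n) \<ominus>\<^bsub>?F\<^esub> (r \<odot>\<^bsub>?F\<^esub> single R (m, n))"
      "r \<in> carrier R" "m \<in> carrier M" "n \<in> carrier N"
    unfolding tensor_rels_def Let_def by blast
  then show ?thesis
  proof cases
    case l
    then have "m \<oplus>\<^bsub>M\<^esub> m' \<in> carrier M" using cl by (auto simp: lin_closed_def)
    with l have "pushforward R ?p h = single R (f m \<oplus>\<^bsub>M'\<^esub> f m', g n) \<ominus>\<^bsub>?F'\<^esub>
        (single R (f m, g n) \<oplus>\<^bsub>?F'\<^esub> single R (f m', g n))"
      using f(1)[of "m \<oplus>\<^bsub>M\<^esub> m'"]
      by (subst l(1), subst pushforward_single_minus_add[where Y = "carrier M' \<times> carrier N'"])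
        (auto simp: f g simp del: free_mod_simps)
    then show ?thesis
      unfolding tensor_rels_def Let_def using l f g by blast
  next
    case r
    then have "n \<oplus>\<^bsub>N\<^esub> n' \<in> carrier N" using cl by (auto simp: lin_closed_def)
    with r have "pushforward R ?p h = single R (f m, g n \<oplus>\<^bsub>N'\<^esub> g n') \<ominus>\<^bsub>?F'\<^esub>
        (single R (f m, g n) \<oplus>\<^bsub>?F'\<^esub> single R (f m, g n'))"
      using g(1)[of "n \<oplus>\<^bsub>N\<^esub> n'"]
      by (subst r(1), subst pushforward_single_minus_add[where Y = "carrier M' \<times> carrier N'"])
        (auto simp: f g simp del: free_mod_simps)
    then show ?thesis
      unfolding tensor_rels_def Let_def using r f g by blast
  next
    case sl
    then have "r \<odot>\<^bsub>M\<^esub> m \<in> carrier M" using cl by (auto simp: lin_closed_def)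
    with sl have "pushforward R ?p h = single R (r \<odot>\<^bsub>M'\<^esub> f m, g n) \<ominus>\<^bsub>?F'\<^esub>
        (r \<odot>\<^bsub>?F'\<^esub> single R (f m, g n))"
      using f(1)[of "r \<odot>\<^bsub>M\<^esub> m"]
      by (subst sl(1), subst pushforward_single_minus_smult[where Y = "carrier M' \<times> carrier N'"])
        (auto simp: f g simp del: free_mod_simps)
    then show ?thesis
      unfolding tensor_rels_def Let_def using sl f g by blast
  next
    case sr
    then have "r \<odot>\<^bsub>N\<^esub> n \<in> carrier N" using cl by (auto simp: lin_closed_def)
    with sr have "pushforward R ?p h = single R (f m, r \<odot>\<^bsub>N'\<^esub> g n) \<ominus>\<^bsub>?F'\<^esub>
        (r \<odot>\<^bsub>?F'\<^esub> single R (f m, g n))"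
      using g(1)[of "r \<odot>\<^bsub>N\<^esub> n"]
      by (subst sr(1), subst pushforward_single_minus_smult[where Y = "carrier M' \<times> carrier N'"])
        (auto simp: f g simp del: free_mod_simps)
    then show ?thesis
      unfolding tensor_rels_def Let_def using sr f g by blast
  qed
qed

lemma pushforward_tensor_free:
  assumes "f \<in> mod_hom R M M'" "g \<in> mod_hom R N N'"
    and "h \<in> carrier (free_mod R (carrier M \<times> carrier N))"
  shows "pushforward R (\<lambda>p. (f (fst p), g (snd p))) h \<in> carrier (free_mod R (carrier M' \<times> carrier N'))"
  using assms(3) by (rule pushforward_closed) (auto simp: mod_homD[OF assms(1)] mod_homD[OF assms(2)])

text \<open>The preimage of the null submodule of the target is a submodule containing all relations
  of the source, hence it contains their span.\<close>

lemma pushforward_tensor_null: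
  assumes cl: "lin_closed R M" "lin_closed R N" "lin_closed R M'" "lin_closed R N'"
    and f: "f \<in> mod_hom R M M'" and g: "g \<in> mod_hom R N N'"
    and h: "h \<in> tensor_null R M N"
  shows "pushforward R (\<lambda>p. (f (fst p), g (snd p))) h \<in> tensor_null R M' N'"
proof -
  let ?p = "\<lambda>p. (f (fst p), g (snd p))"
  let ?F = "free_mod R (carrier M \<times> carrier N)"
  let ?S = "{h \<in> carrier ?F. pushforward R ?p h \<in> tensor_null R M' N'}"
  interpret F: module R ?F by (rule free_mod_module)
  interpret F': module R "free_mod R (carrier M' \<times> carrier N')" by (rule free_mod_module)
  note sub = tensor_null_submodule[OF cl(3,4)]
  note E = F'.submoduleE[OF sub] and c = subsetD[OF F'.submoduleE(1)[OF sub]]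
  have zero: "(\<lambda>_. \<zero>) \<in> tensor_null R M' N'"
    using subgroup.one_closed[OF submodule.axioms(1)[OF sub]] by simp
  have "submodule ?S R ?F"
  proof (rule F.submoduleI)
    fix a b assume "a \<in> ?S" "b \<in> ?S"
    then show "a \<oplus>\<^bsub>?F\<^esub> b \<in> ?S"
      using E(5)[of "pushforward R ?p a" "pushforward R ?p b"]
      by (simp add: free_mod_add pushforward_add[of _ "carrier M \<times> carrier N" _ "carrier M \<times> carrier N"])
  next
    fix a assume "a \<in> ?S"
    then show "\<ominus>\<^bsub>?F\<^esub> a \<in> ?S"
      using E(3)[of "pushforward R ?p a"] c[of "pushforward R ?p a"]
      by (simp add: free_mod_uminus pushforward_uminus[of _ "carrier M \<times> carrier N"])
  next
    fix r a assume "r \<in> carrier R" "a \<in> ?S"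
    then show "r \<odot>\<^bsub>?F\<^esub> a \<in> ?S"
      using E(4)[of r "pushforward R ?p a"]
      by (simp add: free_mod_smult pushforward_smult[of _ _ "carrier M \<times> carrier N"])
  qed (auto simp: zero free_mod_zero)
  moreover have "tensor_rels R M N \<subseteq> ?S"
    using tensor_rels_subset[OF cl(1,2)] pushforward_tensor_rels[OF cl(1,2) f g]
      mod_span_superset[of "tensor_rels R M' N'" R "free_mod R (carrier M' \<times> carrier N')"]
    by (auto simp: tensor_null_def)
  ultimately show ?thesis
    using mod_span_least[of ?S R ?F] h by (auto simp: tensor_null_def)
qed

lemma tensor_map_class:
  assumes cl: "lin_closed R M" "lin_closed R N" "lin_closed R M'" "lin_closed R N'"
    and f: "f \<in> mod_hom R M M'" and g: "g \<in> mod_hom R N N'"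
    and h: "h \<in> carrier (free_mod R UNIV)"
  shows "tensor_map R M' N' f g (tensor_class R M N h) =
    tensor_class R M' N' (pushforward R (\<lambda>p. (f (fst p), g (snd p))) h)"
proof -
  let ?p = "\<lambda>p. (f (fst p), g (snd p))"
  interpret N: abelian_subgroup "tensor_null R M N" "free_mod R (carrier M \<times> carrier N)"
    by (rule tensor_null_abelian_subgroup[OF cl(1,2)])
  have "tensor_class R M' N' (pushforward R ?p k) = tensor_class R M' N' (pushforward R ?p h)"
    if "k \<in> tensor_class R M N h" for k
  proof -
    from that obtain n where n: "n \<in> tensor_null R M N" and k: "k = (\<lambda>p. n p \<oplus> h p)"
      by (auto simp: a_r_coset_def')
    have "pushforward R ?p k = (\<lambda>q. pushforward R ?p n q \<oplus> pushforward R ?p h q)"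
      unfolding k using n h N.a_subset by (intro pushforward_add) auto
    then show ?thesis
      using tensor_class_absorb[OF cl(3,4) pushforward_tensor_null[OF cl f g n] pushforward_closed[OF h]]
      by simp
  qed
  \<comment> \<open>The union over all representatives equals their common value only if there is
    one, so a member of the class is exhibited.\<close>
  moreover have "(\<lambda>p. \<zero> \<oplus> h p) \<in> tensor_class R M N h"
    using subgroup.one_closed[OF submodule.axioms(1)[OF tensor_null_submodule[OF cl(1,2)]]]
    by (auto simp: a_r_coset_def')
  ultimately show ?thesis
    unfolding tensor_map_eq_pushforward by blast
qed

lemma tensor_mod_cases:
  assumes "X \<in> carrier (tensor_mod R M N)"
  obtains h where "h \<in> carrier (free_mod R (carrier M \<times> carrier N))" "X = tensor_class R M N h"
  using assms by (auto simp: carrier_tensor_mod)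

lemma tensor_mod_lin_closed:
  assumes "lin_closed R M" "lin_closed R N"
  shows "lin_closed R (tensor_mod R M N)"
  unfolding lin_closed_def carrier_tensor_mod
  by (auto simp: tensor_mod_add[OF assms] tensor_mod_smult[OF assms] free_mod_add free_mod_smult)

lemma tensor_map_mod_hom:
  assumes cl: "lin_closed R M" "lin_closed R N" "lin_closed R M'" "lin_closed R N'"
    and f: "f \<in> mod_hom R M M'" and g: "g \<in> mod_hom R N N'"
  shows "tensor_map R M' N' f g \<in> mod_hom R (tensor_mod R M N) (tensor_mod R M' N')"
  by (rule mod_homI)
    (auto elim!: tensor_mod_cases simp: tensor_map_class[OF cl f g] free_mod_UNIV
      tensor_mod_add[OF cl(1,2)] tensor_mod_smult[OF cl(1,2)]
      tensor_mod_add[OF cl(3,4)] tensor_mod_smult[OF cl(3,4)]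
      free_mod_add free_mod_smult pushforward_tensor_free[OF f g] carrier_tensor_mod
      pushforward_add[of _ "carrier M \<times> carrier N" _ "carrier M \<times> carrier N"]
      pushforward_smult[of _ _ "carrier M \<times> carrier N"])

lemma tensor_map_minus:
  assumes cl: "lin_closed R M" "lin_closed R N" "lin_closed R M'" "lin_closed R N'"
    and f: "f \<in> mod_hom R M M'" and g: "g \<in> mod_hom R N N'"
    and "X \<in> carrier (tensor_mod R M N)" "Y \<in> carrier (tensor_mod R M N)"
  shows "tensor_map R M' N' f g (X \<ominus>\<^bsub>tensor_mod R M N\<^esub> Y) =
    tensor_map R M' N' f g X \<ominus>\<^bsub>tensor_mod R M' N'\<^esub> tensor_map R M' N' f g Y"
  using assms(7,8)
  by (auto elim!: tensor_mod_cases simp: tensor_map_class[OF cl f g] free_mod_UNIV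
      tensor_mod_minus[OF cl(1,2)] tensor_mod_minus[OF cl(3,4)]
      free_mod_add free_mod_uminus a_minus_def[of R] pushforward_tensor_free[OF f g]
      pushforward_add[of _ "carrier M \<times> carrier N" _ "carrier M \<times> carrier N"]
      pushforward_uminus[of _ "carrier M \<times> carrier N"])

lemma tensor_mod_minus_closed:
  assumes "lin_closed R M" "lin_closed R N"
    and "X \<in> carrier (tensor_mod R M N)" "Y \<in> carrier (tensor_mod R M N)"
  shows "X \<ominus>\<^bsub>tensor_mod R M N\<^esub> Y \<in> carrier (tensor_mod R M N)"
  using assms(3,4)
  by (auto elim!: tensor_mod_cases simp: tensor_mod_minus[OF assms(1,2)] carrier_tensor_mod
      free_mod_add free_mod_uminus a_minus_def[of R])

lemma tensor_map_zero:
  assumes cl: "lin_closed R M" "lin_closed R N" "lin_closed R M'" "lin_closed R N'"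
    and f: "f \<in> mod_hom R M M'" and g: "g \<in> mod_hom R N N'"
  shows "tensor_map R M' N' f g \<zero>\<^bsub>tensor_mod R M N\<^esub> = \<zero>\<^bsub>tensor_mod R M' N'\<^esub>"
  by (simp add: tensor_mod_zero[OF cl(1,2)] tensor_mod_zero[OF cl(3,4)] tensor_map_class[OF cl f g]
      free_mod_zero)

text \<open>The entries \<open>m\<close> and \<open>n\<close> are arbitrary. This makes the lemma
  applicable to the Koszul unit for any function \<open>u\<close>, whose values are not traced
  through the resolution.\<close>

lemma tensor_map_elt:
  assumes cl: "lin_closed R M" "lin_closed R N" "lin_closed R M'" "lin_closed R N'"
    and f: "f \<in> mod_hom R M M'" and g: "g \<in> mod_hom R N N'"
  shows "tensor_map R M' N' f g (tensor_elt R M N m n) = tensor_elt R M' N' (f m) (g n)"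
  unfolding tensor_elt_def by (simp add: tensor_map_class[OF cl f g] free_mod_single)

lemma tensor_map_comp:
  assumes cl: "lin_closed R M" "lin_closed R N" "lin_closed R M'" "lin_closed R N'"
      "lin_closed R M''" "lin_closed R N''"
    and f: "f \<in> mod_hom R M M'" and g: "g \<in> mod_hom R N N'"
    and f': "f' \<in> mod_hom R M' M''" and g': "g' \<in> mod_hom R N' N''"
    and X: "X \<in> carrier (tensor_mod R M N)"
  shows "tensor_map R M'' N'' f' g' (tensor_map R M' N' f g X) =
    tensor_map R M'' N'' (\<lambda>x. f' (f x)) (\<lambda>y. g' (g y)) X"
proof -
  obtain h where h: "h \<in> carrier (free_mod R (carrier M \<times> carrier N))" "X = tensor_class R M N h"
    using X by (rule tensor_mod_cases)
  have "pushforward R (\<lambda>p. (f (fst p), g (snd p))) h \<in> carrier (free_mod R UNIV)"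
    using h(1) by (rule pushforward_closed) simp
  then show ?thesis
    using h(1) unfolding h(2)
    by (simp add: tensor_map_class[OF cl(1-4) f g] tensor_map_class[OF cl(3-6) f' g'] free_mod_UNIV
      tensor_map_class[OF cl(1,2,5,6) mod_hom_comp[OF f f'] mod_hom_comp[OF g g']]
      pushforward_comp[OF h(1)])
qed

text \<open>Members of a class are supported in \<open>carrier M \<times> carrier N\<close>, so
  values of \<open>f\<close> elsewhere never enter. The commutation law of a chain map is available
  on carriers only, which is where this is applied.\<close>

lemma tensor_map_cong:
  assumes cl: "lin_closed R M" "lin_closed R N"
    and "X \<in> carrier (tensor_mod R M N)"
    and f: "\<And>x. x \<in> carrier M \<Longrightarrow> f x = f' x"
  shows "tensor_map R M' N' f g X = tensor_map R M' N' f' g X"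
proof -
  interpret N: abelian_subgroup "tensor_null R M N" "free_mod R (carrier M \<times> carrier N)"
    by (rule tensor_null_abelian_subgroup[OF cl])
  have "pushforward R (\<lambda>p. (f (fst p), g (snd p))) h = pushforward R (\<lambda>p. (f' (fst p), g (snd p))) h"
    if "h \<in> X" for h
  proof -
    have "h \<in> carrier (free_mod R (carrier M \<times> carrier N))"
      using assms(3) that by (auto elim!: tensor_mod_cases intro: N.a_elemrcos_carrier)
    then have "{p \<in> fun_supp R h. (f (fst p), g (snd p)) = q} =
        {p \<in> fun_supp R h. (f' (fst p), g (snd p)) = q}" for q
      using f by (auto simp: mem_free_mod fun_supp_def)
    then show ?thesis
      by (simp add: pushforward_def)
  qed
  then show ?thesis
    unfolding tensor_map_eq_pushforward by simp
qed

end

section \<open>Koszul complexes\<close>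

text \<open>The differential is given by one formula in all degrees, so degree 0 is an arbitrary
  choice; \<open>diff_koszul\<close> then removes the degree from every term.\<close>

definition koszul_diff :: "'a ring \<Rightarrow> 'a list \<Rightarrow> (nat set \<Rightarrow> 'a) \<Rightarrow> nat set \<Rightarrow> 'a" where
  "koszul_diff R xs = diff (koszul R xs) 0"

text \<open>For \<open>i \<notin> T\<close> this is the sign in
  \<open>e\<^sub>i \<and> e\<^sub>T = \<plusminus> e\<^sub>S\<close> with
  \<open>S = insert i T\<close>: the number of transpositions needed to move
  \<open>e\<^sub>i\<close> into place.\<close>

definition koszul_sign :: "'a ring \<Rightarrow> nat set \<Rightarrow> nat \<Rightarrow> 'a" where
  "koszul_sign R T i = (if even (card {j \<in> T. j < i}) then \<one>\<^bsub>R\<^esub> else \<ominus>\<^bsub>R\<^esub> \<one>\<^bsub>R\<^esub>)"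

text \<open>\<open>E\<close> is a null-homotopy of multiplication by \<open>x\<close>. Like the
  differential it is one function for all degrees, as the degree can be read off the size of the
  index sets.\<close>

definition koszul_homotopy ::
  "'a ring \<Rightarrow> 'a list \<Rightarrow> 'a \<Rightarrow> ((nat set \<Rightarrow> 'a) \<Rightarrow> nat set \<Rightarrow> 'a) \<Rightarrow> bool" where
  "koszul_homotopy R xs x E \<longleftrightarrow>
     (\<forall>k. E \<in> mod_hom R (obj (koszul R xs) k) (obj (koszul R xs) (k - 1))) \<and>
     (\<forall>k. \<forall>u\<in>carrier (obj (koszul R xs) k). \<forall>T.
        koszul_diff R xs (E u) T \<oplus>\<^bsub>R\<^esub> E (koszul_diff R xs u) T = x \<otimes>\<^bsub>R\<^esub> u T)"

lemma diff_koszul [simp]: "diff (koszul R xs) k = koszul_diff R xs"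
  by (simp add: koszul_diff_def koszul_def)

context base_ring
begin

lemma koszul_obj_simps [simp]:
  "u \<oplus>\<^bsub>obj (koszul R xs) k\<^esub> v = (\<lambda>p. u p \<oplus> v p)"
  "\<zero>\<^bsub>obj (koszul R xs) k\<^esub> = (\<lambda>_. \<zero>)"
  "r \<odot>\<^bsub>obj (koszul R xs) k\<^esub> u = (\<lambda>p. r \<otimes> u p)"
  by (simp_all add: koszul_def)

text \<open>Finiteness of the support is automatic, since \<open>{..<length xs}\<close> has finitely
  many subsets.\<close>

lemma mem_koszul:
  "u \<in> carrier (obj (koszul R xs) k) \<longleftrightarrow>
     (\<forall>T. u T \<in> carrier R) \<and> (\<forall>T. u T \<noteq> \<zero> \<longrightarrow> T \<subseteq> {..<length xs} \<and> int (card T) = - k)"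
proof -
  have "finite {T. u T \<noteq> \<zero>}" if "\<And>T. u T \<noteq> \<zero> \<Longrightarrow> T \<subseteq> {..<length xs}"
    by (rule finite_subset[of _ "Pow {..<length xs}"]) (use that in auto)
  then show ?thesis
    by (auto simp: koszul_def mem_free_mod)
qed

lemma koszul_closed: "u \<in> carrier (obj (koszul R xs) k) \<Longrightarrow> u T \<in> carrier R"
  by (simp add: mem_koszul)

lemma koszul_add:
  assumes "u \<in> carrier (obj (koszul R xs) k)" "v \<in> carrier (obj (koszul R xs) k)"
  shows "(\<lambda>p. u p \<oplus> v p) \<in> carrier (obj (koszul R xs) k)"
  using assms by (simp add: koszul_def free_mod_add)

lemma koszul_smult:
  assumes "r \<in> carrier R" "u \<in> carrier (obj (koszul R xs) k)"
  shows "(\<lambda>p. r \<otimes> u p) \<in> carrier (obj (koszul R xs) k)"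
  using assms by (simp add: koszul_def free_mod_smult)

lemma koszul_lin_closed: "lin_closed R (obj (koszul R xs) k)"
  by (simp add: lin_closed_def koszul_add koszul_smult)

lemma koszul_sign_closed [simp]: "koszul_sign R T i \<in> carrier R"
  by (simp add: koszul_sign_def)

lemma koszul_sign_square: "a \<in> carrier R \<Longrightarrow> koszul_sign R T i \<otimes> (koszul_sign R T i \<otimes> a) = a"
  by (simp add: koszul_sign_def l_minus r_minus)

text \<open>With the sign as a factor instead of a case distinction, the differential is a sum of
  products and the ring laws apply termwise.\<close>

lemma koszul_diff_apply:
  assumes "set xs \<subseteq> carrier R" "\<And>T. u T \<in> carrier R"
  shows "koszul_diff R xs u T = (if T \<subseteq> {..<length xs}
    then \<Oplus>i\<in>{..<length xs} - T. koszul_sign R T i \<otimes> (xs ! i \<otimes> u (insert i T)) else \<zero>)"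
proof -
  have "xs ! i \<in> carrier R" if "i < length xs" for i
    using assms(1) that by auto
  then show ?thesis
    using assms(2) unfolding koszul_diff_def koszul_def
    by (auto simp: koszul_sign_def l_minus intro!: add.finprod_cong')
qed

lemma koszul_diff_closed:
  assumes "set xs \<subseteq> carrier R" "u \<in> carrier (obj (koszul R xs) k)"
  shows "koszul_diff R xs u \<in> carrier (obj (koszul R xs) (k + 1))"
proof -
  have x: "xs ! i \<in> carrier R" if "i < length xs" for i
    using assms(1) that by auto
  have u: "u T \<in> carrier R" for T using assms(2) by (rule koszul_closed)
  have "T \<subseteq> {..<length xs} \<and> int (card T) = - (k + 1)" if nz: "koszul_diff R xs u T \<noteq> \<zero>" for T
  proof
    show T: "T \<subseteq> {..<length xs}"
      using nz u assms(1) by (auto simp: koszul_diff_apply split: if_splits)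
    \<comment> \<open>A nonzero coefficient at \<open>T\<close> comes from a nonzero coefficient of
      \<open>u\<close> at some \<open>insert i T\<close>, which has one element more; this
      determines the degree.\<close>
    have "\<exists>i\<in>{..<length xs} - T. u (insert i T) \<noteq> \<zero>"
    proof (rule ccontr)
      assume "\<not> ?thesis"
      then have "(\<Oplus>i\<in>{..<length xs} - T. koszul_sign R T i \<otimes> (xs ! i \<otimes> u (insert i T))) = (\<Oplus>i\<in>{..<length xs} - T. \<zero>)"
        using x by (intro add.finprod_cong') auto
      with nz T u assms(1) show False
        by (simp add: koszul_diff_apply)
    qed
    then obtain i where i: "i \<notin> T" "u (insert i T) \<noteq> \<zero>" by auto
    then have "int (card (insert i T)) = - k"
      using assms(2) by (simp add: mem_koszul)
    moreover have "finite T" using T finite_subset by blast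
    ultimately show "int (card T) = - (k + 1)" using i by simp
  qed
  moreover have "koszul_diff R xs u T \<in> carrier R" for T
    using u x assms(1) by (auto simp: koszul_diff_apply intro!: add.finprod_closed)
  ultimately show ?thesis by (simp add: mem_koszul)
qed

lemma koszul_diff_add:
  assumes "set xs \<subseteq> carrier R" "\<And>T. u T \<in> carrier R" "\<And>T. v T \<in> carrier R"
  shows "koszul_diff R xs (\<lambda>T. u T \<oplus> v T) = (\<lambda>T. koszul_diff R xs u T \<oplus> koszul_diff R xs v T)"
proof
  fix T
  have x: "xs ! i \<in> carrier R" if "i < length xs" for i
    using assms(1) that by auto
  have "(\<Oplus>i\<in>{..<length xs} - T. koszul_sign R T i \<otimes> (xs ! i \<otimes> (u (insert i T) \<oplus> v (insert i T)))) =
    (\<Oplus>i\<in>{..<length xs} - T. koszul_sign R T i \<otimes> (xs ! i \<otimes> u (insert i T)) \<oplus>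
      koszul_sign R T i \<otimes> (xs ! i \<otimes> v (insert i T)))"
    using x assms(2,3) by (intro add.finprod_cong') (auto simp: r_distr)
  also have "\<dots> = (\<Oplus>i\<in>{..<length xs} - T. koszul_sign R T i \<otimes> (xs ! i \<otimes> u (insert i T))) \<oplus>
      (\<Oplus>i\<in>{..<length xs} - T. koszul_sign R T i \<otimes> (xs ! i \<otimes> v (insert i T)))"
    using x assms(2,3) by (intro finsum_addf) auto
  finally show "koszul_diff R xs (\<lambda>T. u T \<oplus> v T) T = koszul_diff R xs u T \<oplus> koszul_diff R xs v T"
    using assms by (simp add: koszul_diff_apply)
qed

lemma koszul_diff_smult:
  assumes "set xs \<subseteq> carrier R" "\<And>T. u T \<in> carrier R" "r \<in> carrier R"
  shows "koszul_diff R xs (\<lambda>T. r \<otimes> u T) = (\<lambda>T. r \<otimes> koszul_diff R xs u T)"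
proof
  fix T
  have x: "xs ! i \<in> carrier R" if "i < length xs" for i
    using assms(1) that by auto
  have "(\<Oplus>i\<in>{..<length xs} - T. koszul_sign R T i \<otimes> (xs ! i \<otimes> (r \<otimes> u (insert i T)))) =
    (\<Oplus>i\<in>{..<length xs} - T. r \<otimes> (koszul_sign R T i \<otimes> (xs ! i \<otimes> u (insert i T))))"
    using x assms(2,3) by (intro add.finprod_cong') (auto simp: m_ac)
  also have "\<dots> = r \<otimes> (\<Oplus>i\<in>{..<length xs} - T. koszul_sign R T i \<otimes> (xs ! i \<otimes> u (insert i T)))"
    using x assms(2,3) by (intro finsum_rdistr[symmetric]) auto
  finally show "koszul_diff R xs (\<lambda>T. r \<otimes> u T) T = r \<otimes> koszul_diff R xs u T"
    using assms by (simp add: koszul_diff_apply)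
qed

lemma koszul_diff_mod_hom:
  assumes "set xs \<subseteq> carrier R"
  shows "koszul_diff R xs \<in> mod_hom R (obj (koszul R xs) k) (obj (koszul R xs) (k + 1))"
  by (rule mod_homI)
    (auto simp: koszul_diff_closed assms koszul_diff_add koszul_diff_smult koszul_closed)

lemma koszul_diff_zero:
  assumes "set xs \<subseteq> carrier R"
  shows "koszul_diff R xs (\<lambda>_. \<zero>) = (\<lambda>_. \<zero>)"
  using koszul_diff_smult[OF assms, of "\<lambda>_. \<zero>" \<zero>] koszul_diff_closed[OF assms, of "\<lambda>_. \<zero>" 0]
  by (simp add: mem_koszul)

text \<open>This is \<open>e\<^sub>i \<and> e\<^sub>k = - e\<^sub>k \<and> e\<^sub>i\<close> in
  terms of counts: exactly one of \<open>k < i\<close> and \<open>i < k\<close> holds, so exactly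
  one of the two cardinalities changes by one.\<close>

lemma koszul_sign_insert:
  assumes "finite T" "i \<in> T" "k \<notin> T" "a \<in> carrier R"
  shows "koszul_sign R T k \<otimes> (koszul_sign R (insert k T) i \<otimes> a) =
    \<ominus> (koszul_sign R T i \<otimes> (koszul_sign R (T - {i}) k \<otimes> a))"
proof -
  have ik: "i \<noteq> k" using assms by auto
  have "{j \<in> insert k T. j < i} = (if k < i then insert k {j \<in> T. j < i} else {j \<in> T. j < i})"
    by auto
  then have 1: "card {j \<in> insert k T. j < i} = card {j \<in> T. j < i} + (if k < i then 1 else 0)"
    using assms by simp
  have "{j \<in> T. j < k} = (if i < k then insert i {j \<in> T - {i}. j < k} else {j \<in> T - {i}. j < k})"
    using assms by auto
  then have 2: "card {j \<in> T. j < k} = card {j \<in> T - {i}. j < k} + (if i < k then 1 else 0)"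
    using assms by simp
  show ?thesis
    using ik assms(4) unfolding koszul_sign_def 1 2
    by (cases i k rule: linorder_cases) (auto simp: l_minus r_minus)
qed

text \<open>The homotopy is left exterior multiplication by the basis vector \<open>e\<^sub>i\<close>.\<close>

lemma koszul_homotopy_wedge:
  assumes xs: "set xs \<subseteq> carrier R" and i: "i < length xs"
  shows "koszul_homotopy R xs (xs ! i) (\<lambda>u T. if i \<in> T then koszul_sign R T i \<otimes> u (T - {i}) else \<zero>)"
    (is "koszul_homotopy R xs _ ?E")
  unfolding koszul_homotopy_def
proof (intro conjI allI ballI)
  fix k
  show "?E \<in> mod_hom R (obj (koszul R xs) k) (obj (koszul R xs) (k - 1))"
  proof (rule mod_homI)
    fix u assume u: "u \<in> carrier (obj (koszul R xs) k)"
    have "T \<subseteq> {..<length xs} \<and> int (card T) = - (k - 1)" if "?E u T \<noteq> \<zero>" for T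
    proof -
      have iT: "i \<in> T" and "u (T - {i}) \<noteq> \<zero>" using that by (auto split: if_splits)
      with u have T: "T - {i} \<subseteq> {..<length xs}" and c: "int (card (T - {i})) = - k"
        by (auto simp: mem_koszul)
      from T have "finite T" using finite_subset[of "T - {i}"] by simp
      then have "card T = Suc (card (T - {i}))" using iT by (rule card_Suc_Diff1[symmetric])
      with c T i show ?thesis by auto
    qed
    with u show "?E u \<in> carrier (obj (koszul R xs) (k - 1))"
      by (simp add: mem_koszul)
  next
    fix u v assume "u \<in> carrier (obj (koszul R xs) k)" "v \<in> carrier (obj (koszul R xs) k)"
    then show "?E (u \<oplus>\<^bsub>obj (koszul R xs) k\<^esub> v) = ?E u \<oplus>\<^bsub>obj (koszul R xs) (k - 1)\<^esub> ?E v"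
      by (auto simp: koszul_closed r_distr)
  next
    fix r u assume "r \<in> carrier R" "u \<in> carrier (obj (koszul R xs) k)"
    then show "?E (r \<odot>\<^bsub>obj (koszul R xs) k\<^esub> u) = r \<odot>\<^bsub>obj (koszul R xs) (k - 1)\<^esub> ?E u"
      by (auto simp: koszul_closed m_lcomm)
  qed
next
  fix k u T assume u: "u \<in> carrier (obj (koszul R xs) k)"
  have uc: "u S \<in> carrier R" for S using u by (rule koszul_closed)
  have Ec: "?E u S \<in> carrier R" for S using uc by simp
  have x: "xs ! j \<in> carrier R" if "j < length xs" for j
    using xs that by auto
  have d: "koszul_diff R xs u S \<in> carrier R" for S
    using koszul_diff_closed[OF xs u] by (rule koszul_closed)
  let ?d = "koszul_diff R xs"
  show "?d (?E u) T \<oplus> ?E (?d u) T = xs ! i \<otimes> u T"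
  proof (cases "T \<subseteq> {..<length xs}")
    case False
    then have "\<not> T - {i} \<subseteq> {..<length xs}" using i by auto
    moreover have "u T = \<zero>" using u False by (auto simp: mem_koszul)
    ultimately show ?thesis
      using False x[OF i] by (simp add: koszul_diff_apply[OF xs] Ec uc)
  next
    case T: True
    then have fin: "finite T" by (rule finite_subset) simp
    let ?I = "{..<length xs} - T"
    have dE: "?d (?E u) T = (\<Oplus>j\<in>?I. koszul_sign R T j \<otimes> (xs ! j \<otimes> ?E u (insert j T)))"
      using T by (simp add: koszul_diff_apply[OF xs] Ec)
    show ?thesis
    proof (cases "i \<in> T")
      case False
      \<comment> \<open>Here \<open>?E (?d u) T\<close> is zero, and
        \<open>?E u (insert j T)\<close> survives only if \<open>i\<close> is the inserted index;
        the two equal signs then multiply to one.\<close>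
      have "?d (?E u) T = (\<Oplus>j\<in>?I. if i = j then xs ! i \<otimes> u T else \<zero>)"
        unfolding dE
      proof (rule add.finprod_cong')
        fix j assume j: "j \<in> ?I"
        show "koszul_sign R T j \<otimes> (xs ! j \<otimes> ?E u (insert j T)) = (if i = j then xs ! i \<otimes> u T else \<zero>)"
        proof (cases "i = j")
          case True
          have "{l \<in> insert j T. l < j} = {l \<in> T. l < j}" by auto
          then have "koszul_sign R (insert j T) j = koszul_sign R T j" by (simp add: koszul_sign_def)
          moreover have "insert j T - {j} = T" using j by auto
          ultimately show ?thesis
            using True x[OF i] uc koszul_sign_square[of "xs ! j \<otimes> u T" T j]
            by (simp add: m_lcomm)
        qed (use False x j in auto)
      qed (use x i uc in auto)
      also have "\<dots> = xs ! i \<otimes> u T"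
        using False i x uc by (intro add.finprod_singleton) auto
      finally show ?thesis using False x i uc by simp
    next
      case iT: True
      let ?f = "\<lambda>j. koszul_sign R (T - {i}) j \<otimes> (xs ! j \<otimes> u (insert j (T - {i})))"
      \<comment> \<open>In \<open>?E (?d u) T\<close> the summand that puts \<open>i\<close> back
        yields \<open>xs ! i \<otimes> u T\<close>. The others cancel against those of
        \<open>?d (?E u) T\<close>, whose signs are opposite by
        \<open>koszul_sign_insert\<close>.\<close>
      have I: "{..<length xs} - (T - {i}) = insert i ?I" using i iT by auto
      have fc: "?f j \<in> carrier R" if "j < length xs" for j using x[OF that] uc by simp
      have "?d u (T - {i}) = (\<Oplus>j\<in>insert i ?I. ?f j)"
        using T uc by (auto simp: koszul_diff_apply[OF xs] I)
      also have "\<dots> = ?f i \<oplus> (\<Oplus>j\<in>?I. ?f j)"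
        using iT i x uc by (intro finsum_insert) auto
      finally have du: "?d u (T - {i}) = ?f i \<oplus> (\<Oplus>j\<in>?I. ?f j)" .
      have "{l \<in> T - {i}. l < i} = {l \<in> T. l < i}" by auto
      then have "koszul_sign R (T - {i}) i = koszul_sign R T i" by (simp add: koszul_sign_def)
      then have fi: "koszul_sign R T i \<otimes> ?f i = xs ! i \<otimes> u T"
        using iT x[OF i] uc by (simp add: koszul_sign_square insert_absorb)
      have "?d (?E u) T = (\<Oplus>j\<in>?I. \<ominus> koszul_sign R T i \<otimes> ?f j)"
        unfolding dE
      proof (rule add.finprod_cong')
        fix j assume j: "j \<in> ?I"
        have "insert j T - {i} = insert j (T - {i})" using j iT by auto
        then show "koszul_sign R T j \<otimes> (xs ! j \<otimes> ?E u (insert j T)) = \<ominus> koszul_sign R T i \<otimes> ?f j"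
          using iT j x[of j] uc koszul_sign_insert[OF fin iT, of j "xs ! j \<otimes> u (insert j (T - {i}))"]
          by (simp add: m_lcomm l_minus r_minus)
      qed (use fc in auto)
      also have "\<dots> = \<ominus> koszul_sign R T i \<otimes> (\<Oplus>j\<in>?I. ?f j)"
        using fc by (intro finsum_rdistr[symmetric]) auto
      finally have "?d (?E u) T = \<ominus> koszul_sign R T i \<otimes> (\<Oplus>j\<in>?I. ?f j)" .
      moreover define s where "s = (\<Oplus>j\<in>?I. ?f j)"
      moreover have sc: "s \<in> carrier R" unfolding s_def using fc by (intro finsum_closed) auto
      moreover have "?E (?d u) T = xs ! i \<otimes> u T \<oplus> koszul_sign R T i \<otimes> s"
        using iT fc[OF i] fi sc by (simp add: du s_def[symmetric] r_distr)
      moreover have "\<ominus> (koszul_sign R T i \<otimes> s) \<oplus> (koszul_sign R T i \<otimes> s \<oplus> xs ! i \<otimes> u T) = xs ! i \<otimes> u T"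
        using sc x[OF i] uc by (intro r_neg1) auto
      ultimately show ?thesis
        using sc x[OF i] uc by (simp only: l_minus koszul_sign_closed a_comm m_closed)
    qed
  qed
qed

section \<open>The ideal of elements acting null-homotopically\<close>

lemma koszul_homotopyD:
  assumes "koszul_homotopy R xs x E"
  shows "E \<in> mod_hom R (obj (koszul R xs) k) (obj (koszul R xs) (k - 1))"
    and "u \<in> carrier (obj (koszul R xs) k) \<Longrightarrow>
      koszul_diff R xs (E u) T \<oplus> E (koszul_diff R xs u) T = x \<otimes> u T"
  using assms by (auto simp: koszul_homotopy_def)

text \<open>The differential is linear, so the homotopy equation is linear in the pair of
  \<open>x\<close> and \<open>E\<close>: scaling or adding homotopies scales or adds the elements
  they belong to.\<close>

lemma koszul_homotopy_ideal:
  assumes xs: "set xs \<subseteq> carrier R"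
  shows "ideal {x \<in> carrier R. \<exists>E. koszul_homotopy R xs x E} R"
proof (rule idealI[OF ring_axioms])
  let ?H = "{x \<in> carrier R. \<exists>E. koszul_homotopy R xs x E}"
  let ?K = "\<lambda>k. obj (koszul R xs) k"
  let ?d = "koszul_diff R xs"
  have smult: "r \<otimes> x \<in> ?H" if "r \<in> carrier R" "x \<in> ?H" for r x
  proof -
    from that obtain E where h: "koszul_homotopy R xs x E" by auto
    note E = koszul_homotopyD(1)[OF h] and eq = koszul_homotopyD(2)[OF h]
    have c: "E u T \<in> carrier R" "?d (E u) T \<in> carrier R" "E (?d u) T \<in> carrier R"
      if "u \<in> carrier (?K k)" for u k T
      using mod_homD(1)[OF E that] mod_homD(1)[OF E koszul_diff_closed[OF xs that]] koszul_diff_closed[OF xs mod_homD(1)[OF E that]]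
      by (auto simp: koszul_closed)
    have "koszul_homotopy R xs (r \<otimes> x) (\<lambda>u T. r \<otimes> E u T)"
      unfolding koszul_homotopy_def
    proof (intro conjI allI ballI)
      fix k
      show "(\<lambda>u T. r \<otimes> E u T) \<in> mod_hom R (?K k) (?K (k - 1))"
        using that(1) mod_homD[OF E[of k]] c[of _ k]
        by (intro mod_homI) (auto simp: koszul_smult r_distr m_lcomm)
    next
      fix k u T assume u: "u \<in> carrier (?K k)"
      show "?d (\<lambda>T. r \<otimes> E u T) T \<oplus> r \<otimes> E (?d u) T = r \<otimes> x \<otimes> u T"
        using that(1) that(2) u c[OF u] eq[OF u, of T]
        by (simp add: koszul_diff_smult[OF xs] r_distr[symmetric] m_assoc koszul_closed)
    qed
    with that show ?thesis by auto
  qed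
  have add: "x \<oplus> y \<in> ?H" if "x \<in> ?H" "y \<in> ?H" for x y
  proof -
    from that obtain E F where xy: "x \<in> carrier R" "y \<in> carrier R"
      and hE: "koszul_homotopy R xs x E" and hF: "koszul_homotopy R xs y F" by auto
    note E = koszul_homotopyD(1)[OF hE] and eqE = koszul_homotopyD(2)[OF hE]
    note F = koszul_homotopyD(1)[OF hF] and eqF = koszul_homotopyD(2)[OF hF]
    have c: "E u T \<in> carrier R" "?d (E u) T \<in> carrier R" "E (?d u) T \<in> carrier R"
        "F u T \<in> carrier R" "?d (F u) T \<in> carrier R" "F (?d u) T \<in> carrier R"
      if "u \<in> carrier (?K k)" for u k T
      using mod_homD(1)[OF E that] mod_homD(1)[OF E koszul_diff_closed[OF xs that]] koszul_diff_closed[OF xs mod_homD(1)[OF E that]]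
        mod_homD(1)[OF F that] mod_homD(1)[OF F koszul_diff_closed[OF xs that]] koszul_diff_closed[OF xs mod_homD(1)[OF F that]]
      by (auto simp: koszul_closed)
    have "koszul_homotopy R xs (x \<oplus> y) (\<lambda>u T. E u T \<oplus> F u T)"
      unfolding koszul_homotopy_def
    proof (intro conjI allI ballI)
      fix k
      show "(\<lambda>u T. E u T \<oplus> F u T) \<in> mod_hom R (?K k) (?K (k - 1))"
        using mod_homD[OF E[of k]] mod_homD[OF F[of k]] c[of _ k]
        by (intro mod_homI) (auto simp: koszul_add r_distr a_ac)
    next
      fix k u T assume u: "u \<in> carrier (?K k)"
      show "?d (\<lambda>T. E u T \<oplus> F u T) T \<oplus> (E (?d u) T \<oplus> F (?d u) T) = (x \<oplus> y) \<otimes> u T"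
        using xy c[OF u] eqE[OF u, of T, symmetric] eqF[OF u, of T, symmetric]
        by (simp add: koszul_diff_add[OF xs] l_distr koszul_closed[OF u] a_ac)
    qed
    with that show ?thesis by auto
  qed
  have "koszul_homotopy R xs \<zero> (\<lambda>u T. \<zero>)"
    by (auto simp: koszul_homotopy_def koszul_diff_zero[OF xs] koszul_closed mem_koszul intro!: mod_homI)
  then have zero: "\<zero> \<in> ?H" by auto
  show "subgroup ?H (add_monoid R)"
  proof
    fix x assume "x \<in> ?H"
    then have "\<ominus> x \<in> ?H"
      using smult[of "\<ominus> \<one>" x] by (simp add: l_minus)
    then show "inv\<^bsub>add_monoid R\<^esub> x \<in> ?H"
      by (simp add: a_inv_def)
  qed (use zero add in auto)
  show "a \<otimes> x \<in> ?H" "x \<otimes> a \<in> ?H" if "a \<in> ?H" "x \<in> carrier R" for a x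
    using smult[OF that(2,1)] that by (auto simp: m_comm)
qed

lemma koszul_homotopy_exists:
  assumes xs: "set xs \<subseteq> carrier R" and x: "x \<in> Idl (set xs)"
  shows "\<exists>E. koszul_homotopy R xs x E"
proof -
  have "set xs \<subseteq> {x \<in> carrier R. \<exists>E. koszul_homotopy R xs x E}"
    using xs koszul_homotopy_wedge[OF xs] by (auto simp: in_set_conv_nth subset_iff)
  then show ?thesis
    using genideal_minimal[OF koszul_homotopy_ideal[OF xs]] x by blast
qed

end

section \<open>Splitting off the first entry of the sequence\<close>

lemma chain_mapD:
  assumes "chain_map R C D f"
  shows "f i \<in> mod_hom R (obj C i) (obj D i)"
    and "x \<in> carrier (obj C i) \<Longrightarrow> f (i + 1) (diff C i x) = diff D i (f i x)"
  using assms by (auto simp: chain_map_def)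

text \<open>An element for \<open>x # xs\<close> splits as \<open>v + e\<^sub>0 \<and> w\<close>,
  and this picks out \<open>v\<close>. The new entry takes position 0, so the old indices move up by
  \<open>Suc\<close>.\<close>

definition koszul_drop :: "(nat set \<Rightarrow> 'a) \<Rightarrow> nat set \<Rightarrow> 'a" where
  "koszul_drop u S = u (Suc ` S)"

text \<open>This picks out \<open>w\<close>, the part behind \<open>e\<^sub>0\<close>. Removing
  \<open>e\<^sub>0\<close> raises the cohomological degree by one.\<close>

definition koszul_contract :: "(nat set \<Rightarrow> 'a) \<Rightarrow> nat set \<Rightarrow> 'a" where
  "koszul_contract u S = u (insert 0 (Suc ` S))"

context base_ring
begin

lemma koszul_drop_mod_hom:
  "koszul_drop \<in> mod_hom R (obj (koszul R (x # xs)) k) (obj (koszul R xs) k)"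
proof (rule mod_homI)
  fix u assume u: "u \<in> carrier (obj (koszul R (x # xs)) k)"
  have "S \<subseteq> {..<length xs} \<and> int (card S) = - k" if "koszul_drop u S \<noteq> \<zero>" for S
  proof -
    have "Suc ` S \<subseteq> {..<Suc (length xs)}" "int (card (Suc ` S)) = - k"
      using u that by (auto simp: mem_koszul koszul_drop_def)
    then show ?thesis by (auto simp: card_image)
  qed
  with u show "koszul_drop u \<in> carrier (obj (koszul R xs) k)"
    by (simp add: mem_koszul koszul_drop_def)
qed (simp_all add: koszul_drop_def fun_eq_iff)

lemma koszul_contract_mod_hom:
  "koszul_contract \<in> mod_hom R (obj (koszul R (x # xs)) k) (obj (koszul R xs) (k + 1))"
proof (rule mod_homI)
  fix u assume u: "u \<in> carrier (obj (koszul R (x # xs)) k)"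
  have "S \<subseteq> {..<length xs} \<and> int (card S) = - (k + 1)" if "koszul_contract u S \<noteq> \<zero>" for S
  proof -
    have S: "insert 0 (Suc ` S) \<subseteq> {..<Suc (length xs)}" and c: "int (card (insert 0 (Suc ` S))) = - k"
      using u that by (auto simp: mem_koszul koszul_contract_def)
    from S have "finite (Suc ` S)" by (meson finite_insert finite_lessThan finite_subset)
    then have "card (insert 0 (Suc ` S)) = Suc (card S)" by (simp add: card_image)
    with c S show ?thesis by auto
  qed
  with u show "koszul_contract u \<in> carrier (obj (koszul R xs) (k + 1))"
    by (simp add: mem_koszul koszul_contract_def)
qed (simp_all add: koszul_contract_def fun_eq_iff)

text \<open>Index 0 precedes all others, so removing it costs no sign and contributes
  \<open>x\<close> times the contraction. At sets that avoid 0, the remaining signs survive the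
  shift by \<open>Suc\<close> unchanged.\<close>

lemma koszul_drop_diff:
  assumes xs: "set (x # xs) \<subseteq> carrier R" and u: "u \<in> carrier (obj (koszul R (x # xs)) k)"
  shows "koszul_drop (koszul_diff R (x # xs) u) =
    (\<lambda>S. x \<otimes> koszul_contract u S \<oplus> koszul_diff R xs (koszul_drop u) S)"
proof
  fix S
  have uc: "u T \<in> carrier R" for T using u by (rule koszul_closed)
  have xi: "xs ! i \<in> carrier R" if "i < length xs" for i
    using xs that by auto
  show "koszul_drop (koszul_diff R (x # xs) u) S =
    x \<otimes> koszul_contract u S \<oplus> koszul_diff R xs (koszul_drop u) S"
  proof (cases "S \<subseteq> {..<length xs}")
    case False
    then have nS: "\<not> Suc ` S \<subseteq> {..<Suc (length xs)}" by auto
    then have "u (insert 0 (Suc ` S)) = \<zero>" using u by (auto simp: mem_koszul)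
    with False nS xs show ?thesis
      by (simp add: koszul_drop_def koszul_contract_def koszul_diff_apply uc)
  next
    case True
    let ?g = "\<lambda>i. koszul_sign R (Suc ` S) i \<otimes> ((x # xs) ! i \<otimes> u (insert i (Suc ` S)))"
    have S': "Suc ` S \<subseteq> {..<Suc (length xs)}" using True by auto
    have I: "{..<Suc (length xs)} - Suc ` S = insert 0 (Suc ` ({..<length xs} - S))"
      by (auto simp: lessThan_Suc_eq_insert_0)
    have sgn: "koszul_sign R (Suc ` S) (Suc i) = koszul_sign R S i" for i
    proof -
      have "{j \<in> Suc ` S. j < Suc i} = Suc ` {j \<in> S. j < i}" by auto
      then show ?thesis by (simp add: koszul_sign_def card_image)
    qed
    have "koszul_drop (koszul_diff R (x # xs) u) S = (\<Oplus>i\<in>insert 0 (Suc ` ({..<length xs} - S)). ?g i)"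
      using S' I by (simp add: koszul_drop_def koszul_diff_apply[OF xs] uc)
    also have "\<dots> = ?g 0 \<oplus> (\<Oplus>i\<in>Suc ` ({..<length xs} - S). ?g i)"
      using xs xi uc by (intro finsum_insert) auto
    also have "(\<Oplus>i\<in>Suc ` ({..<length xs} - S). ?g i) = (\<Oplus>i\<in>{..<length xs} - S. ?g (Suc i))"
      using xi uc by (intro finsum_reindex) auto
    also have "\<dots> = koszul_diff R xs (koszul_drop u) S"
      using True xs uc by (simp add: koszul_diff_apply koszul_drop_def sgn)
    also have "?g 0 = x \<otimes> koszul_contract u S"
      using xs uc by (simp add: koszul_contract_def koszul_sign_def)
    finally show ?thesis .
  qed
qed

text \<open>The element 0 lies below every other index and adds one to each count, which flips all
  signs. The sign is written as a scalar factor so that linear maps can pull it out.\<close>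

lemma koszul_contract_diff:
  assumes xs: "set (x # xs) \<subseteq> carrier R" and u: "u \<in> carrier (obj (koszul R (x # xs)) k)"
  shows "koszul_contract (koszul_diff R (x # xs) u) =
    (\<lambda>S. \<ominus> \<one> \<otimes> koszul_diff R xs (koszul_contract u) S)"
proof
  fix S
  have uc: "u T \<in> carrier R" for T using u by (rule koszul_closed)
  have xi: "xs ! i \<in> carrier R" if "i < length xs" for i
    using xs that by auto
  show "koszul_contract (koszul_diff R (x # xs) u) S = \<ominus> \<one> \<otimes> koszul_diff R xs (koszul_contract u) S"
  proof (cases "S \<subseteq> {..<length xs}")
    case False
    then have "\<not> Suc ` S \<subseteq> {..<Suc (length xs)}" by auto
    with False xs show ?thesis
      by (simp add: koszul_contract_def koszul_diff_apply uc)
  next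
    case True
    then have fin: "finite S" by (rule finite_subset) simp
    let ?T = "insert 0 (Suc ` S)"
    let ?g = "\<lambda>i. koszul_sign R ?T i \<otimes> ((x # xs) ! i \<otimes> u (insert i ?T))"
    let ?h = "\<lambda>i. koszul_sign R S i \<otimes> (xs ! i \<otimes> koszul_contract u (insert i S))"
    have T: "?T \<subseteq> {..<Suc (length xs)}" using True by auto
    have I: "{..<Suc (length xs)} - ?T = Suc ` ({..<length xs} - S)"
      by (auto simp: lessThan_Suc_eq_insert_0)
    have hc: "?h i \<in> carrier R" if "i < length xs" for i
      using xi[OF that] uc by (simp add: koszul_contract_def)
    have gh: "?g (Suc i) = \<ominus> \<one> \<otimes> ?h i" if "i < length xs" for i
    proof -
      have "{j \<in> ?T. j < Suc i} = insert 0 (Suc ` {j \<in> S. j < i})" by auto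
      then have "card {j \<in> ?T. j < Suc i} = Suc (card {j \<in> S. j < i})"
        using fin by (simp add: card_image)
      then show ?thesis
        using xi[OF that] uc by (simp add: koszul_sign_def koszul_contract_def insert_commute l_minus)
    qed
    have "koszul_contract (koszul_diff R (x # xs) u) S = (\<Oplus>i\<in>Suc ` ({..<length xs} - S). ?g i)"
      using T I by (simp add: koszul_contract_def koszul_diff_apply[OF xs] uc)
    also have "\<dots> = (\<Oplus>i\<in>{..<length xs} - S. ?g (Suc i))"
      using xi uc by (intro finsum_reindex) auto
    also have "\<dots> = (\<Oplus>i\<in>{..<length xs} - S. \<ominus> \<one> \<otimes> ?h i)"
      using gh hc by (intro add.finprod_cong') auto
    also have "\<dots> = \<ominus> \<one> \<otimes> (\<Oplus>i\<in>{..<length xs} - S. ?h i)"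
      using hc by (intro finsum_rdistr[symmetric]) auto
    also have "\<dots> = \<ominus> \<one> \<otimes> koszul_diff R xs (koszul_contract u) S"
      using True xs uc by (simp add: koszul_diff_apply koszul_contract_def)
    finally show ?thesis .
  qed
qed

section \<open>The comparison map between Koszul complexes\<close>

lemma koszul_hom_zero:
  assumes "f \<in> mod_hom R (obj (koszul R xs) k) (obj (koszul R ys) l)"
  shows "f (\<lambda>_. \<zero>) = (\<lambda>_. \<zero>)"
proof -
  have z: "(\<lambda>_. \<zero>) \<in> carrier (obj (koszul R xs) k)" by (simp add: mem_koszul)
  show ?thesis
    using mod_homD(3)[OF assms zero_closed z] koszul_closed[OF mod_homD(1)[OF assms z]] by simp
qed

text \<open>Given the map \<open>g\<close> for \<open>xs\<close> and a null-homotopy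
  \<open>E\<close> of \<open>x\<close> on the target, \<open>E\<close> after \<open>g\<close> is a
  null-homotopy of \<open>x\<close> times \<open>g\<close>, which is the datum needed to extend
  \<open>g\<close> over the cone. The normalization at \<open>single R {}\<close> is what makes the
  units correspond after tensoring.\<close>

lemma koszul_comparison:
  assumes ys: "set ys \<subseteq> carrier R" and xs: "set xs \<subseteq> Idl (set ys)"
  shows "\<exists>f. chain_map R (koszul R xs) (koszul R ys) (\<lambda>_. f) \<and> f (single R {}) = single R {}"
  using xs
proof (induction xs)
  case Nil
  \<comment> \<open>For the empty sequence all elements are supported at the empty set, so they
    already belong to the target and the identity serves. Both differentials kill them, as
    \<open>insert i S\<close> is never empty.\<close>
  have "u \<in> carrier (obj (koszul R ys) k)" if "u \<in> carrier (obj (koszul R []) k)" for u k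
    using that by (auto simp: mem_koszul)
  moreover have "koszul_diff R [] u = koszul_diff R ys u" if u: "u \<in> carrier (obj (koszul R []) k)" for u k
  proof
    fix T
    have uc: "u S \<in> carrier R" for S using u by (rule koszul_closed)
    have ui: "u (insert i S) = \<zero>" for i S using u by (auto simp: mem_koszul)
    have "(\<Oplus>i\<in>{..<length ys} - T. koszul_sign R T i \<otimes> (ys ! i \<otimes> u (insert i T))) = (\<Oplus>i\<in>{..<length ys} - T. \<zero>)"
      using ys by (intro add.finprod_cong') (auto simp: ui subset_iff)
    then show "koszul_diff R [] u T = koszul_diff R ys u T"
      using ys uc by (simp add: koszul_diff_apply)
  qed
  ultimately have "chain_map R (koszul R []) (koszul R ys) (\<lambda>_ u. u)"
    by (auto simp: chain_map_def intro!: mod_homI)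
  then show ?case by blast
next
  case (Cons x xs)
  then obtain g where g: "chain_map R (koszul R xs) (koszul R ys) (\<lambda>_. g)"
    and g1: "g (single R {}) = single R {}" by auto
  from Cons.prems obtain E where h: "koszul_homotopy R ys x E"
    using koszul_homotopy_exists[OF ys] by auto
  have Idl: "Idl (set ys) \<subseteq> carrier R"
    using ideal.axioms(1)[OF genideal_ideal[OF ys]] by (rule additive_subgroup.a_subset)
  with Cons.prems have xxs: "set (x # xs) \<subseteq> carrier R" and xs: "set xs \<subseteq> carrier R"
    and x: "x \<in> carrier R" by auto
  let ?d = "koszul_diff R ys" and ?K = "obj (koszul R ys)" and ?L = "obj (koszul R (x # xs))"
  let ?Ec = "\<lambda>u. E (g (koszul_contract u))"
  \<comment> \<open>for \<open>u = v + e\<^sub>0 \<and> w\<close> with \<open>v\<close>, \<open>w\<close> not involving \<open>e\<^sub>0\<close>, the image is \<open>g v + E (g w)\<close>\<close>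
  define f where "f u = (\<lambda>T. g (koszul_drop u) T \<oplus> ?Ec u T)" for u
  note E = koszul_homotopyD(1)[OF h] and Eeq = koszul_homotopyD(2)[OF h]
  note gm = chain_mapD(1)[OF g] and gd = chain_mapD(2)[OF g, simplified]
  have g0: "(\<lambda>u. g (koszul_drop u)) \<in> mod_hom R (?L k) (?K k)" for k
    by (rule mod_hom_comp[OF koszul_drop_mod_hom gm])
  have g1': "(\<lambda>u. g (koszul_contract u)) \<in> mod_hom R (?L k) (?K (k + 1))" for k
    by (rule mod_hom_comp[OF koszul_contract_mod_hom gm])
  \<comment> \<open>Contraction raises the degree by one and \<open>E\<close> lowers it again, so
    the composite preserves degrees.\<close>
  have Ec: "?Ec \<in> mod_hom R (?L k) (?K k)" for k
    using mod_hom_comp[OF g1' E] by simp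
  have fm: "f \<in> mod_hom R (?L k) (?K k)" for k
  proof (rule mod_homI)
    fix u assume u: "u \<in> carrier (?L k)"
    show "f u \<in> carrier (?K k)"
      unfolding f_def by (rule koszul_add[OF mod_homD(1)[OF g0 u] mod_homD(1)[OF Ec u]])
    note cu = koszul_closed[OF mod_homD(1)[OF g0 u]] koszul_closed[OF mod_homD(1)[OF Ec u]]
    show "f (r \<odot>\<^bsub>?L k\<^esub> u) = r \<odot>\<^bsub>?K k\<^esub> f u" if "r \<in> carrier R" for r
      using mod_homD(3)[OF g0 that u] mod_homD(3)[OF Ec that u] cu that by (simp add: f_def r_distr)
    fix v assume v: "v \<in> carrier (?L k)"
    note cv = koszul_closed[OF mod_homD(1)[OF g0 v]] koszul_closed[OF mod_homD(1)[OF Ec v]]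
    show "f (u \<oplus>\<^bsub>?L k\<^esub> v) = f u \<oplus>\<^bsub>?K k\<^esub> f v"
      using mod_homD(2)[OF g0 u v] mod_homD(2)[OF Ec u v] cu cv by (simp add: f_def a_ac)
  qed
  have fd: "f (koszul_diff R (x # xs) u) = ?d (f u)" if u: "u \<in> carrier (?L k)" for u k
  proof
    fix T
    note p0 = mod_homD(1)[OF koszul_drop_mod_hom u] and p1 = mod_homD(1)[OF koszul_contract_mod_hom u]
    let ?v = "g (koszul_contract u)"
    have v: "?v \<in> carrier (?K (k + 1))" by (rule mod_homD(1)[OF g1' u])
    have Ev: "E ?v \<in> carrier (?K k)" by (rule mod_homD(1)[OF Ec u])
    have w: "g (koszul_drop u) \<in> carrier (?K k)" by (rule mod_homD(1)[OF g0 u])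
    have "g (koszul_drop (koszul_diff R (x # xs) u)) =
        (\<lambda>T. g (\<lambda>S. x \<otimes> koszul_contract u S) T \<oplus> g (koszul_diff R xs (koszul_drop u)) T)"
      unfolding koszul_drop_diff[OF xxs u]
      using mod_homD(2)[OF gm koszul_smult[OF x p1] koszul_diff_closed[OF xs p0]] by simp
    also have "\<dots> = (\<lambda>T. x \<otimes> ?v T \<oplus> ?d (g (koszul_drop u)) T)"
      using mod_homD(3)[OF gm x p1] gd[OF p0] by simp
    finally have 1: "g (koszul_drop (koszul_diff R (x # xs) u)) T = x \<otimes> ?v T \<oplus> ?d (g (koszul_drop u)) T"
      by simp
    have m1: "\<ominus> \<one> \<in> carrier R" by simp
    have dp1: "koszul_diff R xs (koszul_contract u) \<in> carrier (obj (koszul R xs) (k + 1 + 1))"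
      by (rule koszul_diff_closed[OF xs p1])
    have dv: "?d ?v \<in> carrier (?K (k + 1 + 1))" by (rule koszul_diff_closed[OF ys v])
    have "g (koszul_contract (koszul_diff R (x # xs) u)) = (\<lambda>T. \<ominus> \<one> \<otimes> ?d ?v T)"
      unfolding koszul_contract_diff[OF xxs u]
      using mod_homD(3)[OF gm m1 dp1] gd[OF p1] by simp
    then have 2: "?Ec (koszul_diff R (x # xs) u) T = \<ominus> \<one> \<otimes> E (?d ?v) T"
      using mod_homD(3)[OF E m1 dv] by simp
    have c: "?v T \<in> carrier R" "?d (g (koszul_drop u)) T \<in> carrier R" "?d (E ?v) T \<in> carrier R" "E (?d ?v) T \<in> carrier R"
      using koszul_closed[OF v] koszul_closed[OF koszul_diff_closed[OF ys w]]
        koszul_closed[OF koszul_diff_closed[OF ys Ev]] koszul_closed[OF mod_homD(1)[OF E dv]] by auto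
    have "f (koszul_diff R (x # xs) u) T = x \<otimes> ?v T \<oplus> ?d (g (koszul_drop u)) T \<oplus> \<ominus> \<one> \<otimes> E (?d ?v) T"
      by (simp only: f_def 1 2)
    \<comment> \<open>The homotopy equation replaces \<open>x \<otimes> ?v T\<close> by two terms;
      the one with \<open>E (?d ?v)\<close> cancels against the sign produced by
      contracting.\<close>
    also have "\<dots> = ?d (E ?v) T \<oplus> E (?d ?v) T \<oplus> ?d (g (koszul_drop u)) T \<oplus> \<ominus> E (?d ?v) T"
      using Eeq[OF v, of T] c by (simp add: l_minus)
    also have "\<dots> = ?d (g (koszul_drop u)) T \<oplus> ?d (E ?v) T"
      using c by algebra
    also have "\<dots> = ?d (f u) T"
      unfolding f_def using koszul_closed[OF w] koszul_closed[OF Ev] by (simp add: koszul_diff_add[OF ys])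
    finally show "f (koszul_diff R (x # xs) u) T = ?d (f u) T" .
  qed
  \<comment> \<open>The unit does not involve \<open>e\<^sub>0\<close>, so the correction by
    \<open>E\<close> vanishes on it.\<close>
  have "koszul_contract (single R {}) = (\<lambda>_. \<zero>)" and "koszul_drop (single R {}) = single R {}"
    by (auto simp: koszul_contract_def koszul_drop_def single_def)
  moreover have "?Ec u = (\<lambda>_. \<zero>)" if "koszul_contract u = (\<lambda>_. \<zero>)" for u
    using that koszul_hom_zero[OF gm] koszul_hom_zero[OF E] by simp
  ultimately have "f (single R {}) = single R {}"
    using g1 by (simp add: f_def single_def)
  then show ?case
    using fm fd by (auto simp: chain_map_def)
qed

end

section \<open>Tensor products of complexes\<close>

text \<open>The quasi-isomorphism into \<open>C\<close> is kept and the null-homotopy is composed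
  with \<open>g\<close>. Assumption \<open>D\<close> places both summands of the homotopy equation
  in a carrier, where \<open>g\<close> is additive.\<close>

lemma zero_in_derived_cat_postcomp:
  fixes C :: "('a, 'm) cplx"
  assumes zero: "zero_in_derived_cat R C D f" and g: "chain_map R D D' g"
    and D: "\<And>i x. x \<in> carrier (obj D i) \<Longrightarrow> diff D i x \<in> carrier (obj D (i + 1))"
    and f': "\<And>i x. x \<in> carrier (obj C i) \<Longrightarrow> f' i x = g i (f i x)"
  shows "zero_in_derived_cat R C D' f'"
proof -
  from zero obtain C' :: "('a, 'm) cplx" and s where C': "is_complex R C'" and s: "quasi_iso R C' C s"
    and nh: "null_homotopic R C' D (\<lambda>i x. f i (s i x))"
    by (auto simp: zero_in_derived_cat_def)
  then obtain h where hh: "\<forall>i. h i \<in> mod_hom R (obj C' i) (obj D (i - 1))"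
    and fhh: "\<forall>i. \<forall>x\<in>carrier (obj C' i).
      f i (s i x) = diff D (i - 1) (h i x) \<oplus>\<^bsub>obj D i\<^esub> h (i + 1) (diff C' i x)"
    unfolding null_homotopic_def by blast
  note h = hh[rule_format] and fh = fhh[rule_format]
  have "null_homotopic R C' D' (\<lambda>i x. f' i (s i x))"
    unfolding null_homotopic_def
  proof (intro exI[of _ "\<lambda>i x. g (i - 1) (h i x)"] conjI allI ballI)
    fix i
    show "(\<lambda>x. g (i - 1) (h i x)) \<in> mod_hom R (obj C' i) (obj D' (i - 1))"
      by (rule mod_hom_comp[OF h chain_mapD(1)[OF g]])
    fix x assume x: "x \<in> carrier (obj C' i)"
    have hx: "h i x \<in> carrier (obj D (i - 1))" by (rule mod_homD(1)[OF h x])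
    have "diff C' i \<in> mod_hom R (obj C' i) (obj C' (i + 1))"
      using C' by (auto simp: is_complex_def)
    from mod_homD(1)[OF h mod_homD(1)[OF this x]]
    have hdx: "h (i + 1) (diff C' i x) \<in> carrier (obj D i)" by simp
    have dhx: "diff D (i - 1) (h i x) \<in> carrier (obj D i)"
      using D[OF hx] by simp
    have "s i \<in> mod_hom R (obj C' i) (obj C i)"
      using s by (auto simp: quasi_iso_def chain_map_def)
    from f'[OF mod_homD(1)[OF this x]]
    have "f' i (s i x) = g i (f i (s i x))" .
    also have "\<dots> = g i (diff D (i - 1) (h i x)) \<oplus>\<^bsub>obj D' i\<^esub> g i (h (i + 1) (diff C' i x))"
      unfolding fh[OF x] by (rule mod_homD(2)[OF chain_mapD(1)[OF g] dhx hdx])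
    also have "g i (diff D (i - 1) (h i x)) = diff D' (i - 1) (g (i - 1) (h i x))"
      using chain_mapD(2)[OF g hx] by simp
    finally show "f' i (s i x) = diff D' (i - 1) (g (i - 1) (h i x)) \<oplus>\<^bsub>obj D' i\<^esub>
        g (i + 1 - 1) (h (i + 1) (diff C' i x))"
      by simp
  qed
  with C' s show ?thesis
    by (auto simp: zero_in_derived_cat_def)
qed

text \<open>The counterpart of \<open>lin_closed\<close> for complexes: the linear structure on
  which functoriality of the tensor product of complexes rests.\<close>

definition lin_cplx :: "'a ring \<Rightarrow> ('a, 'm) cplx \<Rightarrow> bool" where
  "lin_cplx R C \<longleftrightarrow> (\<forall>i. lin_closed R (obj C i) \<and> diff C i \<in> mod_hom R (obj C i) (obj C (i + 1)))"

definition tensor_cplx_map ::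
  "'a ring \<Rightarrow> ('a, 'k) cplx \<Rightarrow> ('a, 'm) cplx \<Rightarrow> (int \<Rightarrow> 'l \<Rightarrow> 'k) \<Rightarrow>
   int \<Rightarrow> (int \<Rightarrow> ('l \<times> 'm \<Rightarrow> 'a) set) \<Rightarrow> int \<Rightarrow> ('k \<times> 'm \<Rightarrow> 'a) set" where
  "tensor_cplx_map R K M f n u =
     (\<lambda>i. tensor_map R (obj K i) (obj M (n - i)) (f i) (\<lambda>y. y) (u i))"

text \<open>Separating the two parts of the differential confines the sign to the way they are
  combined. This part starts in component \<open>i - 1\<close>, whose second index
  \<open>n - (i - 1)\<close> has to be recognized as \<open>n + 1 - i\<close> each time.\<close>

definition tensor_diff_left where
  "tensor_diff_left R K M n u i =
     tensor_map R (obj K i) (obj M (n + 1 - i)) (diff K (i - 1)) (\<lambda>y. y) (u (i - 1))"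

definition tensor_diff_right where
  "tensor_diff_right R K M n u i =
     tensor_map R (obj K i) (obj M (n + 1 - i)) (\<lambda>x. x) (diff M (n - i)) (u i)"

context base_ring
begin

section \<open>The differential of a tensor product and its compatibility with induced maps\<close>

lemma tensor_cplx_simps:
  "carrier (obj (tensor_cplx R K M) n) =
     {u. (\<forall>i. u i \<in> carrier (tensor_mod R (obj K i) (obj M (n - i)))) \<and>
         finite {i. u i \<noteq> \<zero>\<^bsub>tensor_mod R (obj K i) (obj M (n - i))\<^esub>}}"
  "u \<oplus>\<^bsub>obj (tensor_cplx R K M) n\<^esub> v = (\<lambda>i. u i \<oplus>\<^bsub>tensor_mod R (obj K i) (obj M (n - i))\<^esub> v i)"
  "r \<odot>\<^bsub>obj (tensor_cplx R K M) n\<^esub> u = (\<lambda>i. r \<odot>\<^bsub>tensor_mod R (obj K i) (obj M (n - i))\<^esub> u i)"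
  "diff (tensor_cplx R K M) n u i =
     (if even i
      then tensor_diff_left R K M n u i \<oplus>\<^bsub>tensor_mod R (obj K i) (obj M (n + 1 - i))\<^esub> tensor_diff_right R K M n u i
      else tensor_diff_left R K M n u i \<ominus>\<^bsub>tensor_mod R (obj K i) (obj M (n + 1 - i))\<^esub> tensor_diff_right R K M n u i)"
  by (simp_all add: tensor_cplx_def Let_def tensor_diff_left_def tensor_diff_right_def)

lemma lin_cplxD:
  assumes "lin_cplx R C"
  shows "lin_closed R (obj C i)" "j = i + 1 \<Longrightarrow> diff C i \<in> mod_hom R (obj C i) (obj C j)"
  using assms by (auto simp: lin_cplx_def)

lemma tensor_diff_left_hom:
  assumes K: "lin_cplx R K" and M: "lin_cplx R M"
  shows "tensor_map R (obj K i) (obj M (n + 1 - i)) (diff K (i - 1)) (\<lambda>y. y) \<in>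
    mod_hom R (tensor_mod R (obj K (i - 1)) (obj M (n - (i - 1)))) (tensor_mod R (obj K i) (obj M (n + 1 - i)))"
proof -
  have eq: "n - (i - 1) = n + 1 - i" by simp
  show ?thesis
    unfolding eq by (intro tensor_map_mod_hom id_mod_hom lin_cplxD[OF K] lin_cplxD[OF M]) simp
qed

lemma tensor_diff_right_hom:
  assumes K: "lin_cplx R K" and M: "lin_cplx R M"
  shows "tensor_map R (obj K i) (obj M (n + 1 - i)) (\<lambda>x. x) (diff M (n - i)) \<in>
    mod_hom R (tensor_mod R (obj K i) (obj M (n - i))) (tensor_mod R (obj K i) (obj M (n + 1 - i)))"
  by (intro tensor_map_mod_hom id_mod_hom lin_cplxD[OF K] lin_cplxD[OF M]) simp

lemma tensor_diff_closed:
  assumes K: "lin_cplx R K" and M: "lin_cplx R M"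
    and u: "u \<in> carrier (obj (tensor_cplx R K M) n)"
  shows "tensor_diff_left R K M n u i \<in> carrier (tensor_mod R (obj K i) (obj M (n + 1 - i)))"
    and "tensor_diff_right R K M n u i \<in> carrier (tensor_mod R (obj K i) (obj M (n + 1 - i)))"
  unfolding tensor_diff_left_def tensor_diff_right_def
  using u mod_homD(1)[OF tensor_diff_left_hom[OF K M]] mod_homD(1)[OF tensor_diff_right_hom[OF K M]]
  by (simp_all add: tensor_cplx_simps)

lemma tensor_cplx_diff_closed:
  assumes K: "lin_cplx R K" and M: "lin_cplx R M"
    and u: "u \<in> carrier (obj (tensor_cplx R K M) n)"
  shows "diff (tensor_cplx R K M) n u \<in> carrier (obj (tensor_cplx R K M) (n + 1))"
proof -
  let ?T = "\<lambda>n i. tensor_mod R (obj K i) (obj M (n - i))"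
  let ?S = "{i. u i \<noteq> \<zero>\<^bsub>?T n i\<^esub>}"
  note Kl = lin_cplxD(1)[OF K] and Ml = lin_cplxD(1)[OF M]
  \<comment> \<open>Component \<open>i\<close> of the differential sees components \<open>i\<close>
    and \<open>i - 1\<close> of \<open>u\<close> alone. Its support thus lies in the support of
    \<open>u\<close> together with a shift by one, and is finite.\<close>
  have zero: "diff (tensor_cplx R K M) n u i = \<zero>\<^bsub>?T (n + 1) i\<^esub>" if "i \<notin> ?S" "i - 1 \<notin> ?S" for i
  proof -
    have eq: "n - (i - 1) = n + 1 - i" by simp
    have dK: "diff K (i - 1) \<in> mod_hom R (obj K (i - 1)) (obj K i)"
      and dM: "diff M (n - i) \<in> mod_hom R (obj M (n - i)) (obj M (n + 1 - i))"
      by (intro lin_cplxD(2)[OF K] lin_cplxD(2)[OF M]; simp)+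
    have "u i = \<zero>\<^bsub>?T n i\<^esub>" "u (i - 1) = \<zero>\<^bsub>tensor_mod R (obj K (i - 1)) (obj M (n + 1 - i))\<^esub>"
      using that(1) that(2)[unfolded mem_Collect_eq eq] by simp_all
    then have "tensor_diff_left R K M n u i = \<zero>\<^bsub>?T (n + 1) i\<^esub>" "tensor_diff_right R K M n u i = \<zero>\<^bsub>?T (n + 1) i\<^esub>"
      unfolding tensor_diff_left_def tensor_diff_right_def
      by (simp_all only: tensor_map_zero[OF Kl Ml Kl Ml dK id_mod_hom] tensor_map_zero[OF Kl Ml Kl Ml id_mod_hom dM])
    then show ?thesis
      by (simp add: tensor_cplx_simps tensor_mod_zero[OF Kl Ml] tensor_mod_add[OF Kl Ml]
          tensor_mod_minus[OF Kl Ml] free_mod_zero a_minus_def[of R])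
  qed
  have "{i. diff (tensor_cplx R K M) n u i \<noteq> \<zero>\<^bsub>?T (n + 1) i\<^esub>} \<subseteq> ?S \<union> (\<lambda>i. i + 1) ` ?S"
  proof
    fix i assume "i \<in> {i. diff (tensor_cplx R K M) n u i \<noteq> \<zero>\<^bsub>?T (n + 1) i\<^esub>}"
    with zero[of i] have "i \<in> ?S \<or> i - 1 \<in> ?S" by blast
    then show "i \<in> ?S \<union> (\<lambda>i. i + 1) ` ?S"
      using imageI[of "i - 1" ?S "\<lambda>i. i + 1"] unfolding diff_add_cancel by blast
  qed
  moreover have "finite ?S" using u by (simp add: tensor_cplx_simps)
  ultimately have "finite {i. diff (tensor_cplx R K M) n u i \<noteq> \<zero>\<^bsub>?T (n + 1) i\<^esub>}"
    by (meson finite_UnI finite_imageI finite_subset)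
  moreover have "diff (tensor_cplx R K M) n u i \<in> carrier (?T (n + 1) i)" for i
    using tensor_diff_closed[OF K M u, of i] tensor_mod_lin_closed[OF Kl Ml]
      tensor_mod_minus_closed[OF Kl Ml]
    by (simp add: tensor_cplx_simps lin_closed_def)
  ultimately show ?thesis
    by (simp add: tensor_cplx_simps(1))
qed

text \<open>The induced map commutes with each part of the differential separately: with the left
  one because \<open>f\<close> is a chain map, with the right one because the two act on different
  factors. The sign depends on the first degree, which \<open>f\<close> preserves.\<close>

lemma tensor_cplx_map_chain_map:
  assumes K: "lin_cplx R K" and K': "lin_cplx R K'" and M: "lin_cplx R M"
    and f: "chain_map R K K' f"
  shows "chain_map R (tensor_cplx R K M) (tensor_cplx R K' M) (tensor_cplx_map R K' M f)"
proof -
  note fm = chain_mapD(1)[OF f] and fd = chain_mapD(2)[OF f]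
  note Kl = lin_cplxD(1)[OF K] and Kl' = lin_cplxD(1)[OF K'] and Ml = lin_cplxD(1)[OF M]
  let ?T = "\<lambda>n i. tensor_mod R (obj K i) (obj M (n - i))"
  let ?T' = "\<lambda>n i. tensor_mod R (obj K' i) (obj M (n - i))"
  have th: "tensor_map R (obj K' i) (obj M j) (f i) (\<lambda>y. y) \<in>
      mod_hom R (tensor_mod R (obj K i) (obj M j)) (tensor_mod R (obj K' i) (obj M j))" for i j
    by (rule tensor_map_mod_hom[OF Kl Ml Kl' Ml fm id_mod_hom])
  have hom: "tensor_cplx_map R K' M f n \<in> mod_hom R (obj (tensor_cplx R K M) n) (obj (tensor_cplx R K' M) n)" for n
  proof (rule mod_homI)
    fix u assume u: "u \<in> carrier (obj (tensor_cplx R K M) n)"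
    have "{i. tensor_cplx_map R K' M f n u i \<noteq> \<zero>\<^bsub>?T' n i\<^esub>} \<subseteq> {i. u i \<noteq> \<zero>\<^bsub>?T n i\<^esub>}"
      by (auto simp: tensor_cplx_map_def tensor_map_zero[OF Kl Ml Kl' Ml fm id_mod_hom])
    then show "tensor_cplx_map R K' M f n u \<in> carrier (obj (tensor_cplx R K' M) n)"
      using u mod_homD(1)[OF th] by (auto simp: tensor_cplx_simps tensor_cplx_map_def intro: finite_subset)
  qed (use mod_homD(2,3)[OF th] in \<open>auto simp: tensor_cplx_simps tensor_cplx_map_def\<close>)
  have "tensor_cplx_map R K' M f (n + 1) (diff (tensor_cplx R K M) n u) i =
      diff (tensor_cplx R K' M) n (tensor_cplx_map R K' M f n u) i"
    if u: "u \<in> carrier (obj (tensor_cplx R K M) n)" for u n i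
  proof -
    let ?g = "tensor_map R (obj K' i) (obj M (n + 1 - i)) (f i) (\<lambda>y. y)"
    have eq: "n - (i - 1) = n + 1 - i" by simp
    have uT: "u j \<in> carrier (?T n j)" for j
      using u by (simp only: tensor_cplx_simps mem_Collect_eq)
    note u0 = uT[of i] and u1 = uT[of "i - 1", unfolded eq]
    have dK: "diff K (i - 1) \<in> mod_hom R (obj K (i - 1)) (obj K i)"
      and dK': "diff K' (i - 1) \<in> mod_hom R (obj K' (i - 1)) (obj K' i)"
      and dM: "diff M (n - i) \<in> mod_hom R (obj M (n - i)) (obj M (n + 1 - i))"
      by (intro lin_cplxD(2)[OF K] lin_cplxD(2)[OF K'] lin_cplxD(2)[OF M]; simp)+
    have "?g (tensor_diff_left R K M n u i) =
        tensor_map R (obj K' i) (obj M (n + 1 - i)) (\<lambda>x. f i (diff K (i - 1) x)) (\<lambda>y. y) (u (i - 1))"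
      unfolding tensor_diff_left_def
      by (rule tensor_map_comp[OF Kl Ml Kl Ml Kl' Ml dK id_mod_hom fm id_mod_hom u1])
    also have "\<dots> = tensor_map R (obj K' i) (obj M (n + 1 - i)) (\<lambda>x. diff K' (i - 1) (f (i - 1) x)) (\<lambda>y. y) (u (i - 1))"
      by (rule tensor_map_cong[OF Kl Ml u1]) (use fd[of _ "i - 1"] in simp)
    also have "\<dots> = tensor_diff_left R K' M n (tensor_cplx_map R K' M f n u) i"
      unfolding tensor_diff_left_def tensor_cplx_map_def eq
      by (rule tensor_map_comp[OF Kl Ml Kl' Ml Kl' Ml fm id_mod_hom dK' id_mod_hom u1, symmetric])
    finally have l: "?g (tensor_diff_left R K M n u i) =
        tensor_diff_left R K' M n (tensor_cplx_map R K' M f n u) i" .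
    have "?g (tensor_diff_right R K M n u i) =
        tensor_map R (obj K' i) (obj M (n + 1 - i)) (f i) (diff M (n - i)) (u i)"
      unfolding tensor_diff_right_def
      by (rule tensor_map_comp[OF Kl Ml Kl Ml Kl' Ml id_mod_hom dM fm id_mod_hom u0])
    also have "\<dots> = tensor_diff_right R K' M n (tensor_cplx_map R K' M f n u) i"
      unfolding tensor_diff_right_def tensor_cplx_map_def
      by (rule tensor_map_comp[OF Kl Ml Kl' Ml Kl' Ml fm id_mod_hom id_mod_hom dM u0, symmetric])
    finally have r: "?g (tensor_diff_right R K M n u i) =
        tensor_diff_right R K' M n (tensor_cplx_map R K' M f n u) i" .
    note c = tensor_diff_closed[OF K M u, of i]
    have "?g (diff (tensor_cplx R K M) n u i) = diff (tensor_cplx R K' M) n (tensor_cplx_map R K' M f n u) i"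
      unfolding tensor_cplx_simps(4)
      using mod_homD(2)[OF th c] tensor_map_minus[OF Kl Ml Kl' Ml fm id_mod_hom c]
      by (simp add: l r)
    then show ?thesis
      by (simp add: tensor_cplx_map_def)
  qed
  with hom show ?thesis
    unfolding chain_map_def by blast
qed

end

section \<open>Derived global sections\<close>

context base_ring
begin

lemma koszul_lin_cplx: "set xs \<subseteq> carrier R \<Longrightarrow> lin_cplx R (koszul R xs)"
  by (simp add: lin_cplx_def koszul_lin_closed koszul_diff_mod_hom)

text \<open>The comparison map goes from the smaller ideal to the larger one, and vanishing travels
  with it. Equal ideals allow both directions.\<close>

lemma koszul_unit_zero_mono:
  assumes xs: "set xs \<subseteq> carrier R" and ys: "set ys \<subseteq> carrier R" and sub: "set xs \<subseteq> Idl (set ys)"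
    and M: "lin_cplx R M"
    and zero: "zero_in_derived_cat R (ring_cplx R) (tensor_cplx R (koszul R xs) M) (koszul_unit R xs M u)"
  shows "zero_in_derived_cat R (ring_cplx R) (tensor_cplx R (koszul R ys) M) (koszul_unit R ys M u)"
proof -
  obtain f where f: "chain_map R (koszul R xs) (koszul R ys) (\<lambda>_. f)" and f1: "f (single R {}) = single R {}"
    using koszul_comparison[OF ys sub] by blast
  note K = koszul_lin_cplx[OF xs] and K' = koszul_lin_cplx[OF ys]
  note cl = lin_cplxD(1)[OF K] lin_cplxD(1)[OF M] lin_cplxD(1)[OF K'] lin_cplxD(1)[OF M]
  note fm = chain_mapD(1)[OF f]
  show ?thesis
  proof (rule zero_in_derived_cat_postcomp[OF zero tensor_cplx_map_chain_map[OF K K' M f]])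
    fix n r
    show "koszul_unit R ys M u n r =
      tensor_cplx_map R (koszul R ys) M (\<lambda>_. f) n (koszul_unit R xs M u n r)"
    proof
      fix i
      \<comment> \<open>Except at \<open>n = 0\<close> and \<open>i = 0\<close> both sides are zero;
        there the first tensor factor is the unit, which \<open>f\<close> fixes.\<close>
      show "koszul_unit R ys M u n r i =
        tensor_cplx_map R (koszul R ys) M (\<lambda>_. f) n (koszul_unit R xs M u n r) i"
        using tensor_map_elt[OF cl fm id_mod_hom, of 0 0 "single R {}" "u r"]
        by (auto simp: koszul_unit_def tensor_cplx_map_def f1 tensor_map_zero[OF cl fm id_mod_hom])
    qed
  qed (rule tensor_cplx_diff_closed[OF K M])
qed

end

section \<open>Elements of the base ring as scalars on global sections\<close>

lemma spec_global_closed: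
  assumes "cring R" "r \<in> carrier R"
  shows "spec_global R r \<in> carrier (sect (Spec R) (pts (Spec R)))"
proof -
  interpret cring R by fact
  have top: "openin (spec_top R) (topspace (spec_top R))" by simp
  have prime: "primeideal P R" if "P \<in> topspace (spec_top R)" for P
    using that by (auto simp: spec_top_def topology_generated_by_topspace)
  have one: "\<one>\<^bsub>R\<^esub> \<notin> P" if "P \<in> topspace (spec_top R)" for P
    using primeideal.I_notcarr[OF prime[OF that]] ideal.one_imp_carrier[OF primeideal.axioms(1)[OF prime[OF that]]]
    by blast
  have "to_loc_prime R P r \<in> carrier (loc_prime R P)" if "P \<in> topspace (spec_top R)" for P
    using one[OF that] assms(2)
    by (auto simp: to_loc_prime_def loc_prime_def localize_def frac_def intro!: quotientI)
  moreover have "\<exists>V. openin (spec_top R) V \<and> P \<in> V \<and> V \<subseteq> topspace (spec_top R) \<and>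
      (\<exists>c\<in>carrier R. \<exists>b\<in>carrier R. \<forall>Q\<in>V. b \<notin> Q \<and> spec_global R r Q = frac R (carrier R - Q) c b)"
    if "P \<in> topspace (spec_top R)" for P
    using one assms(2) top that
    by (intro exI[of _ "topspace (spec_top R)"] conjI bexI[of _ r] bexI[of _ "\<one>\<^bsub>R\<^esub>"])
      (auto simp: spec_global_def Spec_def to_loc_prime_def)
  moreover have "spec_global R r \<in> extensional (topspace (spec_top R))"
    by (simp add: spec_global_def Spec_def)
  ultimately show ?thesis
    by (simp add: Spec_def) (simp add: spec_global_def Spec_def)
qed

text \<open>The ring \<open>R\<close> acts on sections of the resolution through these elements, so
  they must be genuine global sections for the module laws on \<open>Z\<close> to apply.\<close>

lemma structure_hom_closed:
  assumes "cring R" "lrs_morphism Z (Spec R) \<pi> \<phi>" "r \<in> carrier R"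
  shows "structure_hom R \<phi> r \<in> carrier (sect Z (pts Z))"
proof -
  have "preim Z \<pi> (pts (Spec R)) = pts Z"
    using assms(2) by (auto simp: preim_def lrs_morphism_def continuous_map_def)
  then have "\<phi> (pts (Spec R)) \<in> ring_hom (sect (Spec R) (pts (Spec R))) (sect Z (pts Z))"
    using assms(2) openin_topspace[of "topol (Spec R)"] unfolding lrs_morphism_def by metis
  then show ?thesis
    unfolding structure_hom_def by (rule ring_hom_closed) (rule spec_global_closed[OF assms(1,3)])
qed

text \<open>Over \<open>pts Z\<close> the terms of the resolution are modules and the differentials
  are linear over global sections. Both facts pass to \<open>R\<close> along \<open>a\<close>, whose
  values are global sections.\<close>

lemma R_Gamma_lin_cplx:
  assumes a: "\<And>r. r \<in> carrier R \<Longrightarrow> a r \<in> carrier (sect Z (pts Z))"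
    and I: "injective_resolution Z F I"
  shows "lin_cplx R (R_Gamma Z a I)"
proof -
  have m: "Module.module (sect Z (pts Z)) (msect (trm I n) (pts Z))" for n
  proof -
    have "injective_msheaf Z (trm I n)"
      using I[unfolded injective_resolution_def, THEN conjunct1] by (rule spec)
    then have "sheaf_of_modules Z (trm I n)" unfolding injective_msheaf_def by (rule conjunct1)
    from this[unfolded sheaf_of_modules_def, THEN conjunct1, THEN spec, THEN mp, OF openin_topspace]
    show ?thesis .
  qed
  have d: "rdiff I n (pts Z) \<in> mod_hom (sect Z (pts Z)) (msect (trm I n) (pts Z)) (msect (trm I (Suc n)) (pts Z))" for n
  proof -
    have "msheaf_hom Z (trm I n) (trm I (Suc n)) (rdiff I n)"
      using I[unfolded injective_resolution_def, THEN conjunct2, THEN conjunct2, THEN conjunct1] by (rule spec)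
    from this[unfolded msheaf_hom_def, THEN conjunct1, THEN spec, THEN mp, OF openin_topspace]
    show ?thesis .
  qed
  have mon: "abelian_monoid (msect (trm I n) (pts Z))" for n
    by (rule abelian_group.axioms(1)[OF module.axioms(2)[OF m]])
  have zero: "\<zero>\<^bsub>msect (trm I n) (pts Z)\<^esub> \<in> carrier (msect (trm I n) (pts Z))"
    "\<zero>\<^bsub>msect (trm I n) (pts Z)\<^esub> \<oplus>\<^bsub>msect (trm I n) (pts Z)\<^esub> \<zero>\<^bsub>msect (trm I n) (pts Z)\<^esub> =
      \<zero>\<^bsub>msect (trm I n) (pts Z)\<^esub>" for n
    by (rule abelian_monoid.zero_closed[OF mon], rule abelian_monoid.l_zero[OF mon abelian_monoid.zero_closed[OF mon]])
  have add: "x \<oplus>\<^bsub>msect (trm I n) (pts Z)\<^esub> y \<in> carrier (msect (trm I n) (pts Z))"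
    if "x \<in> carrier (msect (trm I n) (pts Z))" "y \<in> carrier (msect (trm I n) (pts Z))" for x y n
    using that by (rule abelian_monoid.a_closed[OF mon])
  have "diff (R_Gamma Z a I) i \<in> mod_hom R (obj (R_Gamma Z a I) i) (obj (R_Gamma Z a I) (i + 1))" for i
  proof (cases "0 \<le> i")
    case True
    then have "nat (i + 1) = Suc (nat i)" by simp
    with True show ?thesis
      using mod_homD[OF d] a by (intro mod_homI) (auto simp: R_Gamma_def restrict_scalars_def)
  next
    case False
    \<comment> \<open>The border needs its own case: from degree -1 the differential enters the full
      module in degree 0, from lower degrees again a zero module.\<close>
    then consider "i = -1" | "i + 1 < 0" by linarith
    then show ?thesis
      using zero module.smult_r_null[OF m a]
      by cases (auto intro!: mod_homI simp: R_Gamma_def restrict_scalars_def zero_mod_def)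
  qed
  moreover have "lin_closed R (obj (R_Gamma Z a I) i)" for i
    using zero add module.smult_closed[OF m a] module.smult_r_null[OF m a]
    by (auto simp: lin_closed_def R_Gamma_def restrict_scalars_def zero_mod_def)
  ultimately show ?thesis
    by (simp add: lin_cplx_def)
qed

section \<open>Independence of the chosen generators\<close>

theorem lemma4p2:
  fixes R :: "'a ring"
    and W :: "('a, 'w) cplx"
    and \<aa> J :: "'a set"
    and Z :: "('p, 's) rspace"
    and \<pi> :: "'p \<Rightarrow> 'a set"
    and \<phi> :: "'a set set \<Rightarrow> ('a set \<Rightarrow> ('a \<times> 'a) set) \<Rightarrow> 's"
    and D :: "'p \<Rightarrow> int"
    and I :: "real \<Rightarrow> ('p, 's, ('p set \<times> 's) set, 'm) resolution"
    and xs ys :: "'a list"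
  assumes "domain R" and "excellent R" and "equal_char_zero R"
    and "dualizing_complex R W"
    and "ideal \<aa> R" and "\<aa> \<noteq> {\<zero>\<^bsub>R\<^esub>}"
    and "ideal J R" and "J \<noteq> {\<zero>\<^bsub>R\<^esub>}"
    and "\<aa> \<subseteq> radical R J"
    and "log_resolution R \<aa> Z \<pi> \<phi> D"
    and "\<And>t. 0 \<le> t \<Longrightarrow> injective_resolution Z (div_sheaf Z (div_floor t D)) (I t)"
    and "set xs \<subseteq> carrier R" and "J = Idl\<^bsub>R\<^esub> (set xs)"
    and "set ys \<subseteq> carrier R" and "J = Idl\<^bsub>R\<^esub> (set ys)"
  shows "c_KH R Z (structure_hom R \<phi>) I xs = c_KH R Z (structure_hom R \<phi>) I ys"
proof -
  interpret domain R by fact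
  interpret base_ring R by unfold_locales
  let ?M = "\<lambda>t. R_Gamma Z (structure_hom R \<phi>) (I t)"
  \<comment> \<open>Resolutions are given for \<open>0 \<le> t\<close>, which is the range of the
    infimum in \<open>c_KH\<close>.\<close>
  have M: "lin_cplx R (?M t)" if "0 \<le> t" for t
    using assms(10) by (intro R_Gamma_lin_cplx[OF structure_hom_closed assms(11)[OF that]])
      (auto simp: log_resolution_def is_cring)
  have sub: "set xs \<subseteq> Idl\<^bsub>R\<^esub> (set ys)" "set ys \<subseteq> Idl\<^bsub>R\<^esub> (set xs)"
    using genideal_self assms(12-15) by metis+
  have "zero_in_derived_cat R (ring_cplx R) (tensor_cplx R (koszul R xs) (?M t)) (koszul_unit R xs (?M t) u) \<longleftrightarrow>
      zero_in_derived_cat R (ring_cplx R) (tensor_cplx R (koszul R ys) (?M t)) (koszul_unit R ys (?M t) u)"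
    if "0 \<le> t" for t u
    using koszul_unit_zero_mono[OF assms(12,14) sub(1) M[OF that]]
      koszul_unit_zero_mono[OF assms(14,12) sub(2) M[OF that]] by blast
  then show ?thesis
    unfolding c_KH_def by (metis (no_types, lifting))
qed

end
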